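(* Let $\mathcal{G}=(\mathcal{N},\mathcal{E})$, $\mathcal{Q}_\mathcal{G}=\{1,\dots,q\}$, the system matrices $A,B,B_w,C,D,D_w$, and $\mathcal{S}$, $E$, $M$, $\tilde A$, $\tilde B$, $\tilde B_w$, $\tilde C$, $\tilde D$, $\mathbb{D}$, $\mathbb{D}^{++}$ be as in the context, let $\gamma\in\mathbb{R}$, and suppose that $\mathcal{Q}_\mathcal{G}^i\neq\emptyset$ for all $i\in\mathcal{N}$ and that, for all distinct $i,j\in\mathcal{N}$, $\mathcal{Q}_\mathcal{G}^i\cap\mathcal{Q}_\mathcal{G}^j\neq\emptyset\Leftrightarrow(i,j)\in\mathcal{E}$. Let $\mathcal{K}_\mathcal{S}^{\infty,\gamma}$ be the set of all $K\in\mathcal{S}$ for which there is $P\in\mathcal{S}$, $P\succ O$, with $$\begin{bmatrix}(A+BK)^\top P+P(A+BK)&PB_w&(C+DK)^\top\\ B_w^\top P&-\gamma I&D_w^\top\\ C+DK&D_w&-\gamma I\end{bmatrix}\prec O .$$ Let $\mathcal{K}_{\mathcal{S},\mathrm{diag}}^{\infty,\gamma}$ be the set of all $K=ZQ^{-1}$ with $Q=\mathrm{blkdiag}(Q_1,\dots,Q_N)\succ O$, $Q_i\in\mathbb{R}^{n_i\times n_i}$, $Z\in\mathcal{S}$, and $$\begin{bmatrix}\mathrm{He}(AQ+BZ)&B_w&QC^\top+Z^\top D^\top\\ B_w^\top&-\gamma I&D_w^\top\\ CQ+DZ&D_w&-\gamma I\end{bmatrix}\prec O .$$ Define $$\Gamma_\gamma(\tilde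 Q,\tilde Z)=\begin{bmatrix}\mathrm{He}(\tilde A\tilde Q+\tilde B\tilde Z)&\tilde B_w&\tilde Q\tilde C^\top+\tilde Z^\top\tilde D^\top\\ \tilde B_w^\top&-\gamma I&D_w^\top\\ \tilde C\tilde Q+\tilde D\tilde Z&D_w&-\gamma I\end{bmatrix},$$ $$\hat{\mathcal{K}}_\mathcal{S}^{\infty,\gamma}=\{(E^\top E)^{-1}E^\top(\tilde Z\tilde Q^{-1})E:\ \tilde Z\in\mathbb{D},\ \tilde Q\in\mathbb{D}^{++},\ \exists\rho\in\mathbb{R}\ \text{s.t.}\ \Gamma_\gamma(\tilde Q,\tilde Z)+\mathrm{blkdiag}(\rho\tilde QM\tilde Q,O,O)\prec O\},$$ $$\hat{\mathcal{K}}_{\mathcal{S},\mathrm{rlx}1}^{\infty,\gamma}=\{(E^\top E)^{-1}E^\top(\tilde Z\tilde Q^{-1})E:\ \tilde Z\in\mathbb{D},\ \tilde Q\in\mathbb{D}^{++},\ \exists\rho\in\mathbb{R},\ \eta>0\ \text{s.t.}\ \tilde QM+M\tilde Q\succeq\eta M,\ \Gamma_\gamma(\tilde Q,\tilde Z)+\mathrm{blkdiag}(\rho M,O,O)\prec O\}.$$ Then $$\mathcal{K}_{\mathcal{S},\mathrm{diag}}^{\infty,\gamma}\subset\hat{\mathcal{K}}_{\mathcal{S},\mathrm{rlx}1}^{\infty,\gamma}\subset\hat{\mathcal{K}}_\mathcal{S}^{\infty,\gamma}\subset\mathcal{K}_\mathcal{S}^{\infty,\gamma}.$$ Moreover, if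 $\mathcal{G}$ is complete, then $\mathcal{K}_{\mathcal{S},\mathrm{diag}}^{\infty,\gamma}\subset\hat{\mathcal{K}}_{\mathcal{S},\mathrm{rlx}1}^{\infty,\gamma}=\hat{\mathcal{K}}_\mathcal{S}^{\infty,\gamma}=\mathcal{K}_\mathcal{S}^{\infty,\gamma}$.
   Context: $\mathcal{G}=(\mathcal{N},\mathcal{E})$ is an undirected graph with $\mathcal{N}=\{1,\dots,N\}$; $\mathcal{E}$ is a set of pairs $(i,j)$ of distinct nodes with $(i,j)\in\mathcal{E}\Leftrightarrow(j,i)\in\mathcal{E}$. A clique is a nonempty $\mathcal{C}\subset\mathcal{N}$ with $(i,j)\in\mathcal{E}$ for all distinct $i,j\in\mathcal{C}$; it is maximal if not contained in another clique. $\mathcal{Q}_\mathcal{G}=\{1,\dots,q\}$ indexes a collection of distinct cliques $\mathcal{C}_1,\dots,\mathcal{C}_q$ of $\mathcal{G}$ (not necessarily all, not necessarily maximal), and $\mathcal{Q}_\mathcal{G}^i=\{k\in\mathcal{Q}_\mathcal{G}: i\in\mathcal{C}_k\}$. Let $n=\sum_{i=1}^N n_i$ with positive integers $n_i$; $n\times n$ matrices are partitioned into blocks $K_{ij}\in\mathbb{R}^{n_i\times n_j}$ (state and input dimensions of each subsystem are taken equal). Define $\mathcal{S}=\{K\in\mathbb{R}^{n\times n}:K_{ij}=O\text{ if }(i,j)\notin\mathcal{E},\ i\neq j\}$. The system is $\dot x=Ax+Bu+B_ww$, $y=Cx+Du+D_ww$ with $u=Kx$, where $A,B\in\mathbb{R}^{n\times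 n}$, $B_w\in\mathbb{R}^{n\times n_w}$, $C,D\in\mathbb{R}^{n_y\times n}$, $D_w\in\mathbb{R}^{n_y\times n_w}$ (by the bounded real lemma, the first matrix inequality with some $P\succ O$ is equivalent to $A+BK$ being Hurwitz with closed-loop $H_\infty$ norm from $w$ to $y$ less than $\gamma$). $E_j=[O_{n_j\times n_1},\dots,I_{n_j},\dots,O_{n_j\times n_N}]\in\mathbb{R}^{n_j\times n}$ (identity in the $j$th block). $n_{\mathcal{C}_k}=\sum_{j\in\mathcal{C}_k}n_j$; $E_{\mathcal{C}_k}\in\mathbb{R}^{n_{\mathcal{C}_k}\times n}$ is obtained by stacking the $E_j$, $j\in\mathcal{C}_k$, vertically (in increasing order of $j$); $E=[E_{\mathcal{C}_1}^\top,\dots,E_{\mathcal{C}_q}^\top]^\top$. When all $\mathcal{Q}_\mathcal{G}^i\ne\emptyset$, $E^\top E$ is invertible (block diagonal with blocks $|\mathcal{Q}_\mathcal{G}^i|I_{n_i}$). $M=I-E(E^\top E)^{-1}E^\top$, $\tilde A=EA(E^\top E)^{-1}E^\top$, $\tilde B=EB(E^\top E)^{-1}E^\top$, $\tilde B_w=EB_w$, $\tilde C=C(E^\top E)^{-1}E^\top$, $\tilde D=D(E^\top E)^{-1}E^\top$. $\mathbb{D}=\{\mathrm{blkdiag}(\tilde P_1,\dots,\tilde P_q):\tilde P_k\in\mathbb{R}^{n_{\mathcal{C}_k}\times n_{\mathcal{C}_k}}\}$, and $\mathbb{D}^{++}$ is the subset of those with every $\tilde P_k\succ O$. $\mathrm{He}(X)=X+X^\top$.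 $X\succ O$ ($X\prec O$) means symmetric positive (negative) definite; $X\succeq Y$ means $X-Y$ is symmetric positive semidefinite. $O$ and $I$ denote zero and identity matrices of conformable size.
   Formalization: In the "Moreover" part for complete G, all cliques C_1,…,C_q of the collection are additionally assumed maximal (so the collection is just the whole node set); without this the stated equalities fail in general. *)

theory Defs
  imports "Jordan_Normal_Form.Gauss_Jordan_Elimination"
begin

text \<open>Nodes and cliques are numbered from 1, matrix rows and columns from 0.\<close>

section \<open>Graphs and cliques\<close>

definition undirected_graph :: "nat \<Rightarrow> (nat \<times> nat) set \<Rightarrow> bool" where
  "undirected_graph N Ed \<longleftrightarrow> Ed \<subseteq> {1..N} \<times> {1..N} \<and> irrefl Ed \<and> sym Ed"

definition complete_graph :: "nat \<Rightarrow> (nat \<times> nat) set \<Rightarrow> bool" where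
  "complete_graph N Ed \<longleftrightarrow> (\<forall>i\<in>{1..N}. \<forall>j\<in>{1..N}. i \<noteq> j \<longrightarrow> (i, j) \<in> Ed)"

definition clique :: "nat \<Rightarrow> (nat \<times> nat) set \<Rightarrow> nat set \<Rightarrow> bool" where
  "clique N Ed c \<longleftrightarrow>
     c \<noteq> {} \<and> c \<subseteq> {1..N} \<and> (\<forall>i\<in>c. \<forall>j\<in>c. i \<noteq> j \<longrightarrow> (i, j) \<in> Ed)"

definition maximal_clique :: "nat \<Rightarrow> (nat \<times> nat) set \<Rightarrow> nat set \<Rightarrow> bool" where
  "maximal_clique N Ed c \<longleftrightarrow> clique N Ed c \<and> \<not> (\<exists>c'. clique N Ed c' \<and> c \<subset> c')"

text \<open>In a nonempty complete graph the only maximal clique is the set of all nodes, so a family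
  of distinct maximal cliques covering the nodes consists of that set alone. Without maximality
  the relaxed gain sets below can be strictly smaller than \<open>K_S\<close> even if the graph is complete:
  a proper clique in the family restricts the block pattern of the admissible \<open>Q\<close>.\<close>

definition cliques_at :: "nat \<Rightarrow> (nat \<Rightarrow> nat set) \<Rightarrow> nat \<Rightarrow> nat set" where
  "cliques_at q Cl i = {k \<in> {1..q}. i \<in> Cl k}"


section \<open>Matrices\<close>

text \<open>The library inverse is option-valued; the value on singular matrices is irrelevant.\<close>

definition minv :: "real mat \<Rightarrow> real mat" where
  "minv X = the (mat_inverse X)"

definition He :: "real mat \<Rightarrow> real mat" where
  "He X = X + X\<^sup>T"

definition pos_def :: "real mat \<Rightarrow> bool" where
  "pos_def X \<longleftrightarrow> square_mat X \<and> X\<^sup>T = X \<and>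
     (\<forall>v\<in>carrier_vec (dim_row X). v \<noteq> 0\<^sub>v (dim_row X) \<longrightarrow> v \<bullet> (X *\<^sub>v v) > 0)"

definition neg_def :: "real mat \<Rightarrow> bool" where
  "neg_def X \<longleftrightarrow> square_mat X \<and> X\<^sup>T = X \<and>
     (\<forall>v\<in>carrier_vec (dim_row X). v \<noteq> 0\<^sub>v (dim_row X) \<longrightarrow> v \<bullet> (X *\<^sub>v v) < 0)"

definition pos_semidef :: "real mat \<Rightarrow> bool" where
  "pos_semidef X \<longleftrightarrow> square_mat X \<and> X\<^sup>T = X \<and>
     (\<forall>v\<in>carrier_vec (dim_row X). v \<bullet> (X *\<^sub>v v) \<ge> 0)"

text \<open>The 3-by-3 block matrix with the arguments listed row by row; the lower left part
  is the horizontal concatenation of \<open>X31\<close> and \<open>X32\<close>.\<close>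

definition block3 ::
  "real mat \<Rightarrow> real mat \<Rightarrow> real mat \<Rightarrow>
   real mat \<Rightarrow> real mat \<Rightarrow> real mat \<Rightarrow>
   real mat \<Rightarrow> real mat \<Rightarrow> real mat \<Rightarrow> real mat" where
  "block3 X11 X12 X13 X21 X22 X23 X31 X32 X33 =
     four_block_mat (four_block_mat X11 X12 X21 X22) (X13 @\<^sub>r X23)
       ((X31\<^sup>T @\<^sub>r X32\<^sup>T)\<^sup>T) X33"

definition vstack :: "nat \<Rightarrow> real mat list \<Rightarrow> real mat" where
  "vstack n Xs = foldr (@\<^sub>r) Xs (0\<^sub>m 0 n)"


section \<open>Block partition and sparsity\<close>

definition dim_sys :: "nat \<Rightarrow> (nat \<Rightarrow> nat) \<Rightarrow> nat" where
  "dim_sys N ns = (\<Sum>i\<in>{1..N}. ns i)"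

definition offset :: "(nat \<Rightarrow> nat) \<Rightarrow> nat \<Rightarrow> nat" where
  "offset ns i = (\<Sum>j\<in>{1..<i}. ns j)"

definition blk :: "(nat \<Rightarrow> nat) \<Rightarrow> nat \<Rightarrow> nat \<Rightarrow> real mat \<Rightarrow> real mat" where
  "blk ns i j K = mat (ns i) (ns j) (\<lambda>(a, b). K $$ (offset ns i + a, offset ns j + b))"

definition sparse_mats :: "nat \<Rightarrow> (nat \<Rightarrow> nat) \<Rightarrow> (nat \<times> nat) set \<Rightarrow> real mat set" where
  "sparse_mats N ns Ed = {K \<in> carrier_mat (dim_sys N ns) (dim_sys N ns).
     \<forall>i\<in>{1..N}. \<forall>j\<in>{1..N}. (i, j) \<notin> Ed \<and> i \<noteq> j \<longrightarrow> blk ns i j K = 0\<^sub>m (ns i) (ns j)}"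

definition E_node :: "nat \<Rightarrow> (nat \<Rightarrow> nat) \<Rightarrow> nat \<Rightarrow> real mat" where
  "E_node N ns j =
     mat (ns j) (dim_sys N ns) (\<lambda>(a, b). if b = offset ns j + a then 1 else 0)"

definition E_clique :: "nat \<Rightarrow> (nat \<Rightarrow> nat) \<Rightarrow> nat set \<Rightarrow> real mat" where
  "E_clique N ns c = vstack (dim_sys N ns) (map (E_node N ns) (sorted_list_of_set c))"

definition E_mat :: "nat \<Rightarrow> (nat \<Rightarrow> nat) \<Rightarrow> nat \<Rightarrow> (nat \<Rightarrow> nat set) \<Rightarrow> real mat" where
  "E_mat N ns q Cl = vstack (dim_sys N ns) (map (\<lambda>k. E_clique N ns (Cl k)) [1..<Suc q])"

definition dim_clique :: "(nat \<Rightarrow> nat) \<Rightarrow> nat set \<Rightarrow> nat" where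
  "dim_clique ns c = (\<Sum>j\<in>c. ns j)"

definition DD :: "(nat \<Rightarrow> nat) \<Rightarrow> nat \<Rightarrow> (nat \<Rightarrow> nat set) \<Rightarrow> real mat set" where
  "DD ns q Cl = {diag_block_mat (map P [1..<Suc q]) | P.
     \<forall>k\<in>{1..q}. P k \<in> carrier_mat (dim_clique ns (Cl k)) (dim_clique ns (Cl k))}"

definition DD_pos :: "(nat \<Rightarrow> nat) \<Rightarrow> nat \<Rightarrow> (nat \<Rightarrow> nat set) \<Rightarrow> real mat set" where
  "DD_pos ns q Cl = {diag_block_mat (map P [1..<Suc q]) | P.
     \<forall>k\<in>{1..q}. P k \<in> carrier_mat (dim_clique ns (Cl k)) (dim_clique ns (Cl k)) \<and>
       pos_def (P k)}"

definition E_pinv :: "real mat \<Rightarrow> real mat" where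
  "E_pinv E = minv (E\<^sup>T * E) * E\<^sup>T"

definition M_mat :: "real mat \<Rightarrow> real mat" where
  "M_mat E = 1\<^sub>m (dim_row E) - E * E_pinv E"


section \<open>Sets of feedback gains\<close>

definition K_S ::
  "nat \<Rightarrow> (nat \<Rightarrow> nat) \<Rightarrow> (nat \<times> nat) set \<Rightarrow> real mat \<Rightarrow> real mat \<Rightarrow> real mat \<Rightarrow>
   real mat \<Rightarrow> real mat \<Rightarrow> real mat \<Rightarrow> real \<Rightarrow> real mat set" where
  "K_S N ns Ed A B Bw C D Dw \<gamma> =
     {K \<in> sparse_mats N ns Ed. \<exists>P \<in> sparse_mats N ns Ed. pos_def P \<and>
        neg_def (block3
          ((A + B * K)\<^sup>T * P + P * (A + B * K)) (P * Bw) ((C + D * K)\<^sup>T)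
          (Bw\<^sup>T * P) (- \<gamma> \<cdot>\<^sub>m 1\<^sub>m (dim_col Dw)) (Dw\<^sup>T)
          (C + D * K) Dw (- \<gamma> \<cdot>\<^sub>m 1\<^sub>m (dim_row Dw)))}"

definition K_diag ::
  "nat \<Rightarrow> (nat \<Rightarrow> nat) \<Rightarrow> (nat \<times> nat) set \<Rightarrow> real mat \<Rightarrow> real mat \<Rightarrow> real mat \<Rightarrow>
   real mat \<Rightarrow> real mat \<Rightarrow> real mat \<Rightarrow> real \<Rightarrow> real mat set" where
  "K_diag N ns Ed A B Bw C D Dw \<gamma> =
     {Z * minv Q | Z Q.
        (\<exists>Qs. (\<forall>i\<in>{1..N}. Qs i \<in> carrier_mat (ns i) (ns i)) \<and>
           Q = diag_block_mat (map Qs [1..<Suc N])) \<and>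
        pos_def Q \<and> Z \<in> sparse_mats N ns Ed \<and>
        neg_def (block3
          (He (A * Q + B * Z)) Bw (Q * C\<^sup>T + Z\<^sup>T * D\<^sup>T)
          (Bw\<^sup>T) (- \<gamma> \<cdot>\<^sub>m 1\<^sub>m (dim_col Dw)) (Dw\<^sup>T)
          (C * Q + D * Z) Dw (- \<gamma> \<cdot>\<^sub>m 1\<^sub>m (dim_row Dw)))}"

definition Gamma ::
  "real mat \<Rightarrow> real mat \<Rightarrow> real mat \<Rightarrow> real mat \<Rightarrow>
   real mat \<Rightarrow> real mat \<Rightarrow> real mat \<Rightarrow> real \<Rightarrow> real mat \<Rightarrow> real mat \<Rightarrow> real mat" where
  "Gamma E A B Bw C D Dw \<gamma> Qt Zt =
     (let At = E * A * E_pinv E; Bt = E * B * E_pinv E; Bwt = E * Bw;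
          Ct = C * E_pinv E; Dt = D * E_pinv E
      in block3
          (He (At * Qt + Bt * Zt)) Bwt (Qt * Ct\<^sup>T + Zt\<^sup>T * Dt\<^sup>T)
          (Bwt\<^sup>T) (- \<gamma> \<cdot>\<^sub>m 1\<^sub>m (dim_col Dw)) (Dw\<^sup>T)
          (Ct * Qt + Dt * Zt) Dw (- \<gamma> \<cdot>\<^sub>m 1\<^sub>m (dim_row Dw)))"

text \<open>\<open>blkdiag(X, O, O)\<close> with the zero blocks of the sizes of the two \<open>-\<gamma>I\<close> blocks above.\<close>

definition corner :: "real mat \<Rightarrow> real mat \<Rightarrow> real mat" where
  "corner Dw X =
     diag_block_mat [X, 0\<^sub>m (dim_col Dw) (dim_col Dw), 0\<^sub>m (dim_row Dw) (dim_row Dw)]"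

definition K_hat ::
  "nat \<Rightarrow> (nat \<Rightarrow> nat) \<Rightarrow> nat \<Rightarrow> (nat \<Rightarrow> nat set) \<Rightarrow> real mat \<Rightarrow> real mat \<Rightarrow> real mat \<Rightarrow>
   real mat \<Rightarrow> real mat \<Rightarrow> real mat \<Rightarrow> real \<Rightarrow> real mat set" where
  "K_hat N ns q Cl A B Bw C D Dw \<gamma> =
     (let E = E_mat N ns q Cl; M = M_mat E in
      {E_pinv E * (Zt * minv Qt) * E | Zt Qt.
         Zt \<in> DD ns q Cl \<and> Qt \<in> DD_pos ns q Cl \<and>
         (\<exists>\<rho>. neg_def (Gamma E A B Bw C D Dw \<gamma> Qt Zt + corner Dw (\<rho> \<cdot>\<^sub>m (Qt * M * Qt))))})"

definition K_rlx1 ::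
  "nat \<Rightarrow> (nat \<Rightarrow> nat) \<Rightarrow> nat \<Rightarrow> (nat \<Rightarrow> nat set) \<Rightarrow> real mat \<Rightarrow> real mat \<Rightarrow> real mat \<Rightarrow>
   real mat \<Rightarrow> real mat \<Rightarrow> real mat \<Rightarrow> real \<Rightarrow> real mat set" where
  "K_rlx1 N ns q Cl A B Bw C D Dw \<gamma> =
     (let E = E_mat N ns q Cl; M = M_mat E in
      {E_pinv E * (Zt * minv Qt) * E | Zt Qt.
         Zt \<in> DD ns q Cl \<and> Qt \<in> DD_pos ns q Cl \<and>
         (\<exists>\<rho> \<eta>. \<eta> > 0 \<and> pos_semidef (Qt * M + M * Qt - \<eta> \<cdot>\<^sub>m M) \<and>
            neg_def (Gamma E A B Bw C D Dw \<gamma> Qt Zt + corner Dw (\<rho> \<cdot>\<^sub>m M)))})"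

end

theory Submission
  imports Defs "Jordan_Normal_Form.Determinant"
begin

text \<open>
  Write \<open>F\<close> for the pseudoinverse of \<open>E\<close>, so that \<open>F E = I\<close> and \<open>M = I - E F\<close> is the orthogonal
  projection onto the complement of the range of \<open>E\<close>. The quadratic forms of all three matrix
  inequalities are values of one function \<open>perf s u w v2 v3\<close>: the triple \<open>(s, u, w)\<close> is \<open>(P x, x, K x)\<close>
  for \<open>K_S\<close>, \<open>(x, Q x, Z x)\<close> for \<open>K_diag\<close>, and \<open>(E\<^sup>T v, F Qt v, F Zt v)\<close> for \<open>Gamma\<close>. Substituting
  \<open>v = Qt\<^bsup>-1\<^esup> E x\<close> kills the term \<open>Qt M Qt\<close> and turns the lifted inequality into the analysis
  inequality with \<open>P = E\<^sup>T Qt\<^bsup>-1\<^esup> E\<close>, which has the required sparsity since each clique contributes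
  only to blocks of its own nodes. The relaxation is stronger than the lifted inequality because
  \<open>Qt M + M Qt \<ge> \<eta> M\<close> implies \<open>M \<le> (4 / \<eta>\<^sup>2) Qt M Qt\<close>. A block diagonal \<open>Q\<close> is lifted to a \<open>Qt\<close> that
  commutes with \<open>M\<close> and satisfies \<open>F Qt F\<^sup>T = Q\<close>, after which a large negative \<open>\<rho>\<close> absorbs all cross
  terms between the range of \<open>E\<close> and its complement (Finsler's argument). For a complete graph with
  maximal cliques \<open>E\<close> is square, so \<open>M = 0\<close>.
\<close>

section \<open>Vectors and definite matrices\<close>

text \<open>The lifted inequality ranges over all of R^m, while \<open>K_S\<close> constrains only
  n-dimensional states. The vectors \<open>v\<close> that represent a state are those with
  \<open>Qt v\<close> in the range of \<open>E\<close>, and they form exactly the kernel of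
  \<open>Qt M Qt\<close>; on the remaining directions a negative \<rho> can offset the extra demand.
  The relaxed penalty \<open>M\<close> no longer contains \<open>Qt\<close>, but its kernel is the
  range of \<open>E\<close>, in general a different subspace. The constraint with \<eta> bridges the
  two, and if \<open>Qt\<close> commutes with \<open>M\<close> both kernels coincide, because
  \<open>Qt\<close> then maps the range of \<open>E\<close> onto itself. The other difficulty is
  multiplicity: \<open>E\<close> copies a node once per clique containing it, and \<open>F\<close>
  averages the copies. Copying the blocks of \<open>Q\<close> and \<open>Z\<close> unchanged into
  the cliques would therefore return them with wrong weights. The lift has to compensate for the
  copies of each node and, for an off-diagonal block of \<open>Z\<close>, for the number of cliques
  that contain both nodes. That every edge lies in some clique of the family is what makes this
  division possible.\<close>

text \<open>The library counterparts of these rules have carrier premises with dimensions that do not occur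
  in the conclusion; premises on dimensions can be discharged by the simplifier.\<close>

lemma mult_mat_assoc_dim:
  "dim_col A = dim_row B \<Longrightarrow> dim_col B = dim_row C \<Longrightarrow> A * B * C = A * (B * (C :: 'a :: semiring_0 mat))"
  by (rule assoc_mult_mat[of _ "dim_row A" "dim_row B" _ "dim_row C" _ "dim_col C"]) auto

lemma mult_mat_vec_assoc_dim:
  "dim_col A = dim_row B \<Longrightarrow> dim_col B = dim_vec v \<Longrightarrow> A * B *\<^sub>v v = A *\<^sub>v (B *\<^sub>v (v :: 'a :: semiring_0 vec))"
  by (rule assoc_mult_mat_vec[of _ "dim_row A" "dim_row B" _ "dim_vec v"]) (auto intro: carrier_vecI)

lemma transpose_mult_dim:
  "dim_col A = dim_row B \<Longrightarrow> (A * B)\<^sup>T = B\<^sup>T * (A :: 'a :: comm_semiring_0 mat)\<^sup>T"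
  by (rule transpose_mult[of _ "dim_row A" "dim_row B" _ "dim_col B"]) auto

lemma transpose_scalar_prod_dim:
  "dim_row A = dim_vec y \<Longrightarrow> dim_col A = dim_vec x \<Longrightarrow>
    ((A :: 'a :: comm_semiring_0 mat)\<^sup>T *\<^sub>v y) \<bullet> x = y \<bullet> (A *\<^sub>v x)"
  by (rule transpose_vec_mult_scalar[of _ "dim_row A" "dim_col A"]) (auto intro: carrier_vecI)

lemma scalar_prod_comm_dim:
  "dim_vec v = dim_vec w \<Longrightarrow> v \<bullet> w = w \<bullet> (v :: 'a :: comm_semiring_0 vec)"
  by (rule comm_scalar_prod[of _ "dim_vec w"]) (auto intro: carrier_vecI)

lemma scalar_prod_add_right_dim:
  "dim_vec u = dim_vec v \<Longrightarrow> dim_vec v = dim_vec w \<Longrightarrow> u \<bullet> (v + w) = u \<bullet> v + u \<bullet> (w :: 'a :: semiring_0 vec)"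
  by (rule scalar_prod_add_distrib[of _ "dim_vec w"]) (auto intro: carrier_vecI)

lemma scalar_prod_add_left_dim:
  "dim_vec u = dim_vec v \<Longrightarrow> dim_vec v = dim_vec w \<Longrightarrow> (u + v) \<bullet> w = u \<bullet> w + v \<bullet> (w :: 'a :: semiring_0 vec)"
  by (rule add_scalar_prod_distrib[of _ "dim_vec w"]) (auto intro: carrier_vecI)

lemma mult_mat_vec_add_dim:
  "dim_col A = dim_vec v \<Longrightarrow> dim_vec v = dim_vec w \<Longrightarrow> A *\<^sub>v (v + w) = A *\<^sub>v v + A *\<^sub>v (w :: 'a :: semiring_0 vec)"
  by (rule mult_add_distrib_mat_vec[of _ "dim_row A" "dim_vec w"]) (auto intro: carrier_vecI)

lemma add_mult_mat_vec_dim: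
  "dim_row A = dim_row B \<Longrightarrow> dim_col A = dim_col B \<Longrightarrow> dim_col B = dim_vec v \<Longrightarrow>
    (A + B) *\<^sub>v v = A *\<^sub>v v + B *\<^sub>v (v :: 'a :: semiring_0 vec)"
  by (rule add_mult_distrib_mat_vec[of _ "dim_row A" "dim_vec v"]) (auto intro: carrier_vecI)

lemma smult_mult_mat_vec_dim:
  "dim_col A = dim_vec v \<Longrightarrow> (k \<cdot>\<^sub>m A) *\<^sub>v v = k \<cdot>\<^sub>v (A *\<^sub>v (v :: 'a :: comm_semiring_0 vec))"
  by (rule eq_vecI) auto

lemma transpose_add_dim:
  "dim_row A = dim_row B \<Longrightarrow> dim_col A = dim_col B \<Longrightarrow> (A + B)\<^sup>T = A\<^sup>T + B\<^sup>T"
  by (rule eq_matI) auto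

lemma transpose_minus_dim:
  "dim_row A = dim_row B \<Longrightarrow> dim_col A = dim_col B \<Longrightarrow> (A - B)\<^sup>T = A\<^sup>T - B\<^sup>T"
  by (rule eq_matI) auto

lemma mult_mat_zero_vec_dim:
  "dim_col A = n \<Longrightarrow> A *\<^sub>v 0\<^sub>v n = (0\<^sub>v (dim_row A) :: 'a :: semiring_0 vec)"
  by (rule eq_vecI) auto

lemma one_mult_mat_vec_dim: "dim_vec v = n \<Longrightarrow> 1\<^sub>m n *\<^sub>v v = (v :: 'a :: semiring_1 vec)"
  by (rule one_mult_mat_vec) (rule carrier_vecI)

lemma add_mat_comm_dim:
  "dim_row A = dim_row B \<Longrightarrow> dim_col A = dim_col B \<Longrightarrow> A + B = B + (A :: 'a :: ab_semigroup_add mat)"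
  by (rule eq_matI) (auto simp: add.commute)

lemma zero_mult_mat_vec_dim: "dim_vec v = c \<Longrightarrow> 0\<^sub>m r c *\<^sub>v v = (0\<^sub>v r :: 'a :: semiring_0 vec)"
  by (rule eq_vecI) (auto simp: scalar_prod_def)

lemma transpose_smult_mat: "(k \<cdot>\<^sub>m A)\<^sup>T = k \<cdot>\<^sub>m A\<^sup>T"
  by (rule eq_matI) auto

lemma quadratic_form_uminus:
  "X \<in> carrier_mat k k \<Longrightarrow> v \<in> carrier_vec k \<Longrightarrow> v \<bullet> (- X *\<^sub>v v) = - (v \<bullet> (X *\<^sub>v (v :: 'a :: ring vec)))"
  by simp

lemmas dim_simps = transpose_add_dim transpose_minus_dim mult_mat_assoc_dim mult_mat_vec_assoc_dim transpose_mult_dim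
  mult_mat_vec_add_dim add_mult_mat_vec_dim scalar_prod_add_right_dim scalar_prod_add_left_dim

lemma scalar_prod_self_nonneg: "0 \<le> v \<bullet> (v :: real vec)"
  by (auto simp: scalar_prod_def intro!: sum_nonneg)

lemma scalar_prod_self_pos:
  assumes "v \<in> carrier_vec n" "v \<noteq> 0\<^sub>v n"
  shows "0 < v \<bullet> (v :: real vec)"
  using conjugate_square_greater_0_vec[of v n] assms by simp

lemma scalar_prod_self_eq_0:
  assumes "v \<in> carrier_vec n" "v \<bullet> (v :: real vec) = 0"
  shows "v = 0\<^sub>v n"
  using scalar_prod_self_pos[of v n] assms by fastforce

text \<open>Expand the nonnegative square of \<open>s u - v / s\<close> with
  \<open>s = sqrt t\<close>. The free weight \<open>t\<close> decides which of the two squares gets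
  the small coefficient when a cross term is absorbed.\<close>

lemma scalar_prod_young:
  assumes "dim_vec u = dim_vec (v :: real vec)" "0 < t"
  shows "2 * (u \<bullet> v) \<le> t * (u \<bullet> u) + (v \<bullet> v) / t"
proof -
  define s where "s = sqrt t"
  have s: "s > 0" "t = s * s" using assms by (auto simp: s_def)
  have "0 \<le> (s \<cdot>\<^sub>v u - (1/s) \<cdot>\<^sub>v v) \<bullet> (s \<cdot>\<^sub>v u - (1/s) \<cdot>\<^sub>v v)" (is "_ \<le> ?x")
    by (rule scalar_prod_self_nonneg)
  also have "?x = (\<Sum>i\<in>{0..<dim_vec v}. (s * u $ i - (1/s) * v $ i) * (s * u $ i - (1/s) * v $ i))"
    using assms by (auto simp: scalar_prod_def)
  also have "\<dots> = (\<Sum>i\<in>{0..<dim_vec v}. t * (u $ i * u $ i) + (v $ i * v $ i) / t - 2 * (u $ i * v $ i))"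
    by (rule sum.cong) (use s in \<open>auto simp: field_simps\<close>)
  also have "\<dots> = t * (u \<bullet> u) + (v \<bullet> v) / t - 2 * (u \<bullet> v)"
    using assms by (simp add: scalar_prod_def sum_subtractf sum.distrib sum_distrib_left sum_divide_distrib)
  finally show ?thesis by simp
qed

section \<open>Bounds for quadratic forms and matrix-vector products\<close>

lemma quadratic_form_bounded:
  assumes X: "X \<in> carrier_mat n n"
  obtains c :: real where "c > 0" "\<And>v. v \<in> carrier_vec n \<Longrightarrow> v \<bullet> (X *\<^sub>v v) \<le> c * (v \<bullet> v)"
proof -
  \<comment> \<open>The summand 1 keeps \<open>c\<close> positive when \<open>X\<close> vanishes;
    the bound is later used with division by \<open>c\<close>.\<close>
  define c where "c = 1 + (\<Sum>i<n. \<Sum>j<n. \<bar>X $$ (i, j)\<bar>)"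
  have "c > 0" unfolding c_def by (auto intro!: add_pos_nonneg sum_nonneg)
  moreover have "v \<bullet> (X *\<^sub>v v) \<le> c * (v \<bullet> v)" if v: "v \<in> carrier_vec n" for v
  proof -
    have sq: "v $ i * v $ i \<le> v \<bullet> v" if "i < n" for i
      using v that unfolding scalar_prod_def
      by (auto intro!: member_le_sum[of i "{0..<n}" "\<lambda>i. v $ i * v $ i"])
    have le: "v $ i * X $$ (i, j) * v $ j \<le> \<bar>X $$ (i, j)\<bar> * (v \<bullet> v)" if "i < n" "j < n" for i j
    proof -
      have "\<bar>v $ i * v $ j\<bar> \<le> v \<bullet> v"
        using sq[OF that(1)] sq[OF that(2)] zero_le_power2[of "\<bar>v $ i\<bar> - \<bar>v $ j\<bar>"]
        by (simp add: power2_eq_square algebra_simps abs_mult)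
      hence "\<bar>X $$ (i, j)\<bar> * \<bar>v $ i * v $ j\<bar> \<le> \<bar>X $$ (i, j)\<bar> * (v \<bullet> v)"
        by (intro mult_left_mono) auto
      moreover have "v $ i * X $$ (i, j) * v $ j \<le> \<bar>X $$ (i, j)\<bar> * \<bar>v $ i * v $ j\<bar>"
        by (simp add: abs_mult[symmetric] ac_simps)
      ultimately show ?thesis by linarith
    qed
    have "v \<bullet> (X *\<^sub>v v) = (\<Sum>i<n. \<Sum>j<n. v $ i * X $$ (i, j) * v $ j)"
      using X v by (auto simp: scalar_prod_def sum_distrib_left atLeast0LessThan ac_simps intro!: sum.cong)
    also have "\<dots> \<le> (\<Sum>i<n. \<Sum>j<n. \<bar>X $$ (i, j)\<bar> * (v \<bullet> v))"
      by (intro sum_mono le) auto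
    also have "\<dots> \<le> c * (v \<bullet> v)"
      using scalar_prod_self_nonneg[of v] by (simp add: c_def sum_distrib_right[symmetric] distrib_right)
    finally show ?thesis .
  qed
  ultimately show ?thesis using that by blast
qed

lemma mult_mat_vec_bounded:
  assumes X: "X \<in> carrier_mat k n"
  obtains c :: real where "c > 0" "\<And>v. v \<in> carrier_vec n \<Longrightarrow> (X *\<^sub>v v) \<bullet> (X *\<^sub>v v) \<le> c * (v \<bullet> v)"
proof -
  have "X\<^sup>T * X \<in> carrier_mat n n" using X by auto
  from quadratic_form_bounded[OF this] obtain c where
    c: "c > 0" "\<And>v. v \<in> carrier_vec n \<Longrightarrow> v \<bullet> ((X\<^sup>T * X) *\<^sub>v v) \<le> c * (v \<bullet> v)" by blast
  have "(X *\<^sub>v v) \<bullet> (X *\<^sub>v v) = v \<bullet> ((X\<^sup>T * X) *\<^sub>v v)" if "v \<in> carrier_vec n" for v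
    using X that transpose_scalar_prod_dim[of "X\<^sup>T" v "X *\<^sub>v v"]
    by (simp add: mult_mat_vec_assoc_dim)
  thus ?thesis using c that by metis
qed

section \<open>Inverses and definite matrices\<close>

lemma minv_eqI:
  assumes "X \<in> carrier_mat n n" "Y \<in> carrier_mat n n" "X * Y = 1\<^sub>m n"
  shows "minv X = Y"
proof -
  have YX: "Y * X = 1\<^sub>m n" using mat_mult_left_right_inverse assms by blast
  \<comment> \<open>Being a unit rules out the value \<open>None\<close> of
    \<open>mat_inverse\<close>; uniqueness of the inverse then identifies the value with
    \<open>Y\<close>.\<close>
  have "X \<in> Units (ring_mat TYPE(real) n ())"
    using assms YX by (auto simp: Units_def ring_mat_simps)
  then obtain Y' where Y': "mat_inverse X = Some Y'" using mat_inverse(1)[OF assms(1)] by fastforce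
  from mat_inverse(2)[OF assms(1) Y'] have *: "X * Y' = 1\<^sub>m n" "Y' \<in> carrier_mat n n" by auto
  have "Y' = Y * X * Y'" using YX * by simp
  also have "\<dots> = Y" using assms * by (simp add: mult_mat_assoc_dim)
  finally show ?thesis using Y' by (simp add: minv_def)
qed

lemma pos_def_iff:
  assumes "X \<in> carrier_mat n n"
  shows "pos_def X \<longleftrightarrow> X\<^sup>T = X \<and> (\<forall>v\<in>carrier_vec n. v \<noteq> 0\<^sub>v n \<longrightarrow> v \<bullet> (X *\<^sub>v v) > 0)"
  using assms unfolding pos_def_def by auto

lemma neg_def_iff:
  assumes "X \<in> carrier_mat n n"
  shows "neg_def X \<longleftrightarrow> X\<^sup>T = X \<and> (\<forall>v\<in>carrier_vec n. v \<noteq> 0\<^sub>v n \<longrightarrow> v \<bullet> (X *\<^sub>v v) < 0)"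
  using assms unfolding neg_def_def by auto

lemma pos_semidef_iff:
  assumes "X \<in> carrier_mat n n"
  shows "pos_semidef X \<longleftrightarrow> X\<^sup>T = X \<and> (\<forall>v\<in>carrier_vec n. v \<bullet> (X *\<^sub>v v) \<ge> 0)"
  using assms unfolding pos_semidef_def by auto

text \<open>The form at \<open>v\<close> is the form of \<open>X\<close> at \<open>G v\<close>,
  which is nonzero by injectivity. Inverses, the Lyapunov matrix \<open>P\<close> and the clique
  blocks of the lifted \<open>Q\<close> all get their definiteness from here.\<close>

lemma pos_def_congruence:
  assumes X: "X \<in> carrier_mat n n" "pos_def X" and G: "G \<in> carrier_mat n k"
    and inj: "\<And>v. v \<in> carrier_vec k \<Longrightarrow> G *\<^sub>v v = 0\<^sub>v n \<Longrightarrow> v = 0\<^sub>v k"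
  shows "pos_def (G\<^sup>T * X * G)"
proof -
  have sym: "X\<^sup>T = X" using X by (simp add: pos_def_iff)
  have "v \<bullet> ((G\<^sup>T * X * G) *\<^sub>v v) > 0" if v: "v \<in> carrier_vec k" "v \<noteq> 0\<^sub>v k" for v
  proof -
    have "v \<bullet> ((G\<^sup>T * X * G) *\<^sub>v v) = (G *\<^sub>v v) \<bullet> (X *\<^sub>v (G *\<^sub>v v))"
      using X G v transpose_scalar_prod_dim[of "G\<^sup>T" v "X *\<^sub>v (G *\<^sub>v v)"]
      by (simp add: dim_simps)
    moreover have "G *\<^sub>v v \<noteq> 0\<^sub>v n" "G *\<^sub>v v \<in> carrier_vec n" using inj v G by auto
    ultimately show ?thesis using X by (simp add: pos_def_iff)
  qed
  thus ?thesis using X G sym by (subst pos_def_iff[of _ k]) (auto simp: dim_simps)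
qed

lemma pos_def_minv:
  assumes X: "X \<in> carrier_mat n n" "pos_def X"
  shows "minv X \<in> carrier_mat n n" "X * minv X = 1\<^sub>m n" "minv X * X = 1\<^sub>m n" "pos_def (minv X)"
proof -
  have "det X \<noteq> 0"
    using X by (force simp: det_0_iff_vec_prod_zero[OF X(1)] pos_def_iff)
  from det_non_zero_imp_unit[OF X(1) this, of "()"]
  obtain Y where Y: "Y \<in> carrier_mat n n" "X * Y = 1\<^sub>m n" "Y * X = 1\<^sub>m n"
    by (auto simp: Units_def ring_mat_simps)
  have minv: "minv X = Y" using minv_eqI[OF X(1)] Y by blast
  have sym: "X\<^sup>T = X" using X by (simp add: pos_def_iff)
  have "Y\<^sup>T * X = (X * Y)\<^sup>T" using X Y(1) sym transpose_mult_dim[of X Y] by simp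
  hence "Y\<^sup>T * X = 1\<^sub>m n" by (simp only: Y transpose_one)
  hence "Y\<^sup>T * (X * Y) = Y" using X Y mult_mat_assoc_dim[of "Y\<^sup>T" X Y] by simp
  hence symY: "Y\<^sup>T = Y" using Y by simp
  \<comment> \<open>Since \<open>Y\<close> is symmetric and inverse to \<open>X\<close>, this
    congruence of \<open>X\<close> is \<open>Y\<close> itself.\<close>
  have "pos_def (Y\<^sup>T * X * Y)"
  proof (rule pos_def_congruence[OF X Y(1)])
    fix v assume v: "v \<in> carrier_vec n" "Y *\<^sub>v v = 0\<^sub>v n"
    have "v = X *\<^sub>v (Y *\<^sub>v v)"
      using v X Y mult_mat_vec_assoc_dim[of X Y v] by simp
    thus "v = 0\<^sub>v n" using v X by (simp add: mult_mat_zero_vec_dim)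
  qed
  hence "pos_def Y" using Y symY by (simp add: mult_mat_assoc_dim)
  thus "minv X \<in> carrier_mat n n" "X * minv X = 1\<^sub>m n" "minv X * X = 1\<^sub>m n" "pos_def (minv X)"
    using Y minv by auto
qed

text \<open>Cauchy-Schwarz for the form \<open>X\<close> at \<open>v\<close> and \<open>X\<^bsup>-1\<^esup> v\<close> gives an explicit constant; no
  compactness of the unit sphere is needed.\<close>

lemma pos_def_lower_bound:
  assumes X: "X \<in> carrier_mat n n" "pos_def X"
  obtains e :: real where "e > 0" "\<And>v. v \<in> carrier_vec n \<Longrightarrow> e * (v \<bullet> v) \<le> v \<bullet> (X *\<^sub>v v)"
proof -
  note Y = pos_def_minv[OF X]
  from quadratic_form_bounded[OF Y(1)] obtain c where
    c: "c > 0" "\<And>v. v \<in> carrier_vec n \<Longrightarrow> v \<bullet> (minv X *\<^sub>v v) \<le> c * (v \<bullet> v)" by blast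
  have sym: "X\<^sup>T = X" using X by (simp add: pos_def_iff)
  have "(1 / c) * (v \<bullet> v) \<le> v \<bullet> (X *\<^sub>v v)" if v: "v \<in> carrier_vec n" for v
  proof -
    \<comment> \<open>The form at \<open>w\<close> is
      \<open>v X v - (2/c) v v + (1/c)^2 v X^-1 v\<close>. The choice of \<open>c\<close> bounds the
      last term by \<open>(1/c) v v\<close>, so nonnegativity leaves the claimed estimate.\<close>
    define w where "w = v + (- 1 / c) \<cdot>\<^sub>v (minv X *\<^sub>v v)"
    have w: "w \<in> carrier_vec n" using v Y by (simp add: w_def)
    have XY: "X *\<^sub>v (minv X *\<^sub>v v) = v" using X Y v mult_mat_vec_assoc_dim[of X "minv X" v] by simp
    have "0 \<le> w \<bullet> (X *\<^sub>v w)"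
    proof (cases "w = 0\<^sub>v n")
      case True
      thus ?thesis using X by (simp add: scalar_prod_left_zero[of _ n])
    next
      case False
      thus ?thesis using X w by (simp add: pos_def_iff less_imp_le)
    qed
    also have "X *\<^sub>v w = X *\<^sub>v v + (- 1 / c) \<cdot>\<^sub>v v"
      using X Y v XY by (simp add: w_def mult_mat_vec_add_dim mult_mat_vec)
    also have "w \<bullet> \<dots> = v \<bullet> (X *\<^sub>v v) - (1/c) * (v \<bullet> v) - (1 / c) * ((minv X *\<^sub>v v) \<bullet> (X *\<^sub>v v))
        + (1/c)\<^sup>2 * ((minv X *\<^sub>v v) \<bullet> v)"
      using X Y v by (simp add: w_def dim_simps power2_eq_square algebra_simps)
    also have "(minv X *\<^sub>v v) \<bullet> (X *\<^sub>v v) = v \<bullet> v"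
      using X Y v sym XY transpose_scalar_prod_dim[of X "minv X *\<^sub>v v" v] by simp
    also have "(minv X *\<^sub>v v) \<bullet> v = v \<bullet> (minv X *\<^sub>v v)"
      using Y v by (intro scalar_prod_comm_dim) auto
    also have "(1/c)\<^sup>2 * (v \<bullet> (minv X *\<^sub>v v)) \<le> (1/c)\<^sup>2 * (c * (v \<bullet> v))"
      using c v by (intro mult_left_mono) auto
    also have "\<dots> = (1/c) * (v \<bullet> v)" using c by (simp add: power2_eq_square)
    finally show ?thesis by simp
  qed
  thus ?thesis using that[of "1/c"] c by simp
qed

section \<open>Quadratic forms of block matrices\<close>

lemma mult_four_block_mat_vec:
  assumes "A \<in> carrier_mat r1 c1" "B \<in> carrier_mat r1 c2" "C \<in> carrier_mat r2 c1" "D \<in> carrier_mat r2 c2"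
    and "x \<in> carrier_vec c1" "y \<in> carrier_vec c2"
  shows "four_block_mat A B C D *\<^sub>v (x @\<^sub>v y) = (A *\<^sub>v x + B *\<^sub>v y) @\<^sub>v (C *\<^sub>v x + D *\<^sub>v (y :: 'a :: comm_semiring_0 vec))"
proof (rule eq_vecI)
  fix i assume "i < dim_vec ((A *\<^sub>v x + B *\<^sub>v y) @\<^sub>v (C *\<^sub>v x + D *\<^sub>v y))"
  hence i: "i < r1 + r2" using assms by simp
  show "(four_block_mat A B C D *\<^sub>v (x @\<^sub>v y)) $ i = ((A *\<^sub>v x + B *\<^sub>v y) @\<^sub>v (C *\<^sub>v x + D *\<^sub>v y)) $ i"
  proof (cases "i < r1")
    case True
    thus ?thesis using assms i
      by (simp add: row_four_block_mat(1)[OF assms(1-4)] scalar_prod_append[of _ c1 _ c2])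
  next
    case False
    hence "i - r1 < r2" using i by simp
    thus ?thesis using assms i False
      by (simp add: row_four_block_mat(2)[OF assms(1-4)] scalar_prod_append[of _ c1 _ c2])
  qed
qed (use assms in auto)

lemma quadratic_form_four_block:
  assumes "U \<in> carrier_mat a a" "R \<in> carrier_mat a b" "V \<in> carrier_mat b b"
    and "x \<in> carrier_vec a" "y \<in> carrier_vec b"
  shows "(x @\<^sub>v y) \<bullet> (four_block_mat U R R\<^sup>T V *\<^sub>v (x @\<^sub>v y))
    = x \<bullet> (U *\<^sub>v x) + 2 * (x \<bullet> (R *\<^sub>v y)) + y \<bullet> (V *\<^sub>v (y :: 'a :: comm_ring_1 vec))"
proof -
  have "y \<bullet> (R\<^sup>T *\<^sub>v x) = x \<bullet> (R *\<^sub>v y)"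
    using assms transpose_scalar_prod_dim[of R x y] scalar_prod_comm_dim[of y "R\<^sup>T *\<^sub>v x"] by simp
  thus ?thesis using assms
    by (simp add: mult_four_block_mat_vec[of _ a a _ b _ b] scalar_prod_append[of _ a _ b]
        scalar_prod_add_right_dim)
qed

text \<open>\<open>four_block_mat\<close> reads its dimensions off the diagonal blocks, so the other
  arguments may be arbitrary.\<close>

lemma block3_carrier:
  assumes "U \<in> carrier_mat p p"
  shows "block3 U X12 X13 X21 (- \<gamma> \<cdot>\<^sub>m 1\<^sub>m nw) X23 X31 X32 (- \<gamma> \<cdot>\<^sub>m 1\<^sub>m ny) \<in> carrier_mat (p + nw + ny) (p + nw + ny)"
  using assms by (auto simp: block3_def)

lemma transpose_block3:
  assumes U: "U \<in> carrier_mat p p" and Bw: "Bw \<in> carrier_mat p nw"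
    and S: "S \<in> carrier_mat ny p" and Dw: "Dw \<in> carrier_mat ny nw"
  shows "(block3 U Bw S\<^sup>T Bw\<^sup>T (- \<gamma> \<cdot>\<^sub>m 1\<^sub>m nw) Dw\<^sup>T S Dw (- \<gamma> \<cdot>\<^sub>m 1\<^sub>m ny))\<^sup>T = block3 U\<^sup>T Bw S\<^sup>T Bw\<^sup>T (- \<gamma> \<cdot>\<^sub>m 1\<^sub>m nw) Dw\<^sup>T S Dw (- \<gamma> \<cdot>\<^sub>m 1\<^sub>m ny)"
proof -
  \<comment> \<open>\<open>block3\<close> builds its lower left part as the transpose of two stacked
    transposes. For the arguments used here that part is literally \<open>R\<^sup>T\<close>, so the
    matrix has a symmetric two-by-two pattern.\<close>
  define R where "R = S\<^sup>T @\<^sub>r Dw\<^sup>T"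
  have R: "R \<in> carrier_mat (p + nw) ny" using S Dw by (auto simp: R_def)
  have tI: "(- \<gamma> \<cdot>\<^sub>m 1\<^sub>m k)\<^sup>T = - \<gamma> \<cdot>\<^sub>m 1\<^sub>m k" for k by (rule eq_matI) auto
  show ?thesis
    using U Bw R unfolding block3_def transpose_transpose R_def[symmetric]
    by (subst transpose_four_block_mat[of _ "p + nw" "p + nw" _ ny _ ny])
       (auto simp: tI transpose_four_block_mat[of _ p p _ nw _ nw])
qed

lemma quadratic_form_block3:
  assumes U: "U \<in> carrier_mat p p" and Bw: "Bw \<in> carrier_mat p nw"
    and S: "S \<in> carrier_mat ny p" and Dw: "Dw \<in> carrier_mat ny nw"
    and v: "v1 \<in> carrier_vec p" "v2 \<in> carrier_vec nw" "v3 \<in> carrier_vec ny"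
  shows "((v1 @\<^sub>v v2) @\<^sub>v v3) \<bullet> ((block3 U Bw S\<^sup>T Bw\<^sup>T (- \<gamma> \<cdot>\<^sub>m 1\<^sub>m nw) Dw\<^sup>T S Dw (- \<gamma> \<cdot>\<^sub>m 1\<^sub>m ny)) *\<^sub>v ((v1 @\<^sub>v v2) @\<^sub>v v3)) =
      v1 \<bullet> (U *\<^sub>v v1) + 2 * (v1 \<bullet> (Bw *\<^sub>v v2)) + 2 * (v3 \<bullet> (S *\<^sub>v v1)) + 2 * (v3 \<bullet> (Dw *\<^sub>v v2))
        - \<gamma> * (v2 \<bullet> v2) - \<gamma> * (v3 \<bullet> v3)"
proof -
  define R where "R = S\<^sup>T @\<^sub>r Dw\<^sup>T"
  define H where "H = four_block_mat U Bw Bw\<^sup>T (- \<gamma> \<cdot>\<^sub>m 1\<^sub>m nw)"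
  have R: "R \<in> carrier_mat (p + nw) ny" using S Dw by (auto simp: R_def)
  have H: "H \<in> carrier_mat (p + nw) (p + nw)" using U by (auto simp: H_def)
  have "R *\<^sub>v v3 = (S\<^sup>T *\<^sub>v v3) @\<^sub>v (Dw\<^sup>T *\<^sub>v v3)"
    using v S Dw unfolding R_def by (intro mat_mult_append) auto
  moreover have "v1 \<bullet> (S\<^sup>T *\<^sub>v v3) = v3 \<bullet> (S *\<^sub>v v1)"
    using v S transpose_scalar_prod_dim[of "S\<^sup>T" v1 v3] scalar_prod_comm_dim[of v3 "S *\<^sub>v v1"] by simp
  moreover have "v2 \<bullet> (Dw\<^sup>T *\<^sub>v v3) = v3 \<bullet> (Dw *\<^sub>v v2)"
    using v Dw transpose_scalar_prod_dim[of "Dw\<^sup>T" v2 v3] scalar_prod_comm_dim[of v3 "Dw *\<^sub>v v2"] by simp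
  ultimately show ?thesis
    unfolding block3_def transpose_transpose R_def[symmetric] H_def[symmetric]
    using v U Bw S Dw H R
    by (subst quadratic_form_four_block[of _ "p + nw" _ ny])
       (auto simp: H_def quadratic_form_four_block[of _ p _ nw] scalar_prod_append[of _ p _ nw] smult_mult_mat_vec_dim)
qed

text \<open>Every vector splits uniquely into three pieces, so definiteness becomes a sign condition
  on triples. This is the form in which the different inequalities are compared.\<close>

lemma neg_def_block3:
  assumes U: "U \<in> carrier_mat p p" "U\<^sup>T = U" and Bw: "Bw \<in> carrier_mat p nw"
    and S: "S \<in> carrier_mat ny p" and Dw: "Dw \<in> carrier_mat ny nw"
  shows "neg_def (block3 U Bw S\<^sup>T Bw\<^sup>T (- \<gamma> \<cdot>\<^sub>m 1\<^sub>m nw) Dw\<^sup>T S Dw (- \<gamma> \<cdot>\<^sub>m 1\<^sub>m ny)) \<longleftrightarrow>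
    (\<forall>v1\<in>carrier_vec p. \<forall>v2\<in>carrier_vec nw. \<forall>v3\<in>carrier_vec ny.
      \<not> (v1 = 0\<^sub>v p \<and> v2 = 0\<^sub>v nw \<and> v3 = 0\<^sub>v ny) \<longrightarrow>
      v1 \<bullet> (U *\<^sub>v v1) + 2 * (v1 \<bullet> (Bw *\<^sub>v v2)) + 2 * (v3 \<bullet> (S *\<^sub>v v1)) + 2 * (v3 \<bullet> (Dw *\<^sub>v v2))
        - \<gamma> * (v2 \<bullet> v2) - \<gamma> * (v3 \<bullet> v3) < 0)"
proof -
  have "(v1 @\<^sub>v v2) @\<^sub>v v3 = 0\<^sub>v (p + nw + ny) \<longleftrightarrow> v1 = 0\<^sub>v p \<and> v2 = 0\<^sub>v nw \<and> v3 = 0\<^sub>v ny"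
    if "v1 \<in> carrier_vec p" "v2 \<in> carrier_vec nw" "v3 \<in> carrier_vec ny" for v1 v2 v3 :: "real vec"
  proof -
    have "0\<^sub>v (p + nw + ny) = (0\<^sub>v p @\<^sub>v 0\<^sub>v nw) @\<^sub>v (0\<^sub>v ny :: real vec)" by auto
    thus ?thesis using that
      by (simp add: append_vec_eq[of _ "p + nw"] append_vec_eq[of _ p])
  qed
  thus ?thesis
    unfolding neg_def_iff[OF block3_carrier[OF U(1)]] transpose_block3[OF U(1) Bw S Dw] U(2)
    by (simp add: all_vec_append quadratic_form_block3[OF U(1) Bw S Dw])
qed

lemma block3_add_corner:
  assumes "U \<in> carrier_mat p p" "X \<in> carrier_mat p p" "Bw \<in> carrier_mat p nw"
    and "S \<in> carrier_mat ny p" and Dw: "Dw \<in> carrier_mat ny nw"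
  shows "block3 U Bw S\<^sup>T Bw\<^sup>T (- \<gamma> \<cdot>\<^sub>m 1\<^sub>m nw) Dw\<^sup>T S Dw (- \<gamma> \<cdot>\<^sub>m 1\<^sub>m ny) + corner Dw X
    = block3 (U + X) Bw S\<^sup>T Bw\<^sup>T (- \<gamma> \<cdot>\<^sub>m 1\<^sub>m nw) Dw\<^sup>T S Dw (- \<gamma> \<cdot>\<^sub>m 1\<^sub>m ny)"
  using assms by (intro eq_matI) (auto simp: block3_def corner_def append_rows_def Let_def)

section \<open>Closed-loop inequalities\<close>

text \<open>The dimensions of a matrix sum are those of its second summand, here the
  transpose.\<close>

lemma He_dims [simp]: "dim_row (He T) = dim_col T" "dim_col (He T) = dim_row T"
  by (auto simp: He_def)

lemma He_carrier: "T \<in> carrier_mat p p \<Longrightarrow> He T \<in> carrier_mat p p"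
  by (rule carrier_matI) auto

lemma quadratic_form_He:
  assumes "T \<in> carrier_mat p p" "v \<in> carrier_vec p"
  shows "v \<bullet> (He T *\<^sub>v v) = 2 * (v \<bullet> (T *\<^sub>v v))"
  using assms transpose_scalar_prod_dim[of T v v] scalar_prod_comm_dim[of v "T\<^sup>T *\<^sub>v v"]
  by (simp add: He_def dim_simps)

lemma He_symmetric: "T \<in> carrier_mat p p \<Longrightarrow> (He T)\<^sup>T = He T"
  unfolding He_def by (rule eq_matI) auto

section \<open>The plant and its performance form\<close>

locale plant =
  fixes n nw ny :: nat and A B Bw C D Dw :: "real mat" and \<gamma> :: real
  assumes A: "A \<in> carrier_mat n n" and B: "B \<in> carrier_mat n n" and Bw: "Bw \<in> carrier_mat n nw"
    and C: "C \<in> carrier_mat ny n" and D: "D \<in> carrier_mat ny n" and Dw: "Dw \<in> carrier_mat ny nw"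
begin

lemmas plant_dims [simp] = carrier_matD[OF A] carrier_matD[OF B] carrier_matD[OF Bw]
  carrier_matD[OF C] carrier_matD[OF D] carrier_matD[OF Dw]

lemmas plant_carriers [simp] = A B Bw C D Dw

text \<open>The dissipation rate behind the bounded real lemma. For \<open>s = P x\<close>,
  \<open>u = x\<close>, \<open>w = K x\<close> the terms with \<open>s\<close> are the derivative of
  the storage function \<open>x P x\<close> along the closed loop under the disturbance
  \<open>v2\<close>. For positive \<gamma>, maximising the remaining terms over \<open>v3\<close>
  gives \<open>|y|^2 / \<gamma> - \<gamma> |v2|^2\<close>, where \<open>y\<close> is the
  output.\<close>

definition perf :: "real vec \<Rightarrow> real vec \<Rightarrow> real vec \<Rightarrow> real vec \<Rightarrow> real vec \<Rightarrow> real" where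
  "perf s u w v2 v3 = 2 * (s \<bullet> (A *\<^sub>v u + B *\<^sub>v w + Bw *\<^sub>v v2)) + 2 * (v3 \<bullet> (C *\<^sub>v u + D *\<^sub>v w))
    + 2 * (v3 \<bullet> (Dw *\<^sub>v v2)) - \<gamma> * (v2 \<bullet> v2) - \<gamma> * (v3 \<bullet> v3)"

definition neg_on :: "nat \<Rightarrow> (real vec \<Rightarrow> real vec \<Rightarrow> real vec \<Rightarrow> real) \<Rightarrow> bool" where
  "neg_on p f \<longleftrightarrow> (\<forall>v1\<in>carrier_vec p. \<forall>v2\<in>carrier_vec nw. \<forall>v3\<in>carrier_vec ny.
      \<not> (v1 = 0\<^sub>v p \<and> v2 = 0\<^sub>v nw \<and> v3 = 0\<^sub>v ny) \<longrightarrow> f v1 v2 v3 < 0)"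

lemma neg_on_cong:
  assumes "\<And>v1 v2 v3. v1 \<in> carrier_vec p \<Longrightarrow> v2 \<in> carrier_vec nw \<Longrightarrow> v3 \<in> carrier_vec ny \<Longrightarrow> f v1 v2 v3 = g v1 v2 v3"
  shows "neg_on p f \<longleftrightarrow> neg_on p g"
  unfolding neg_on_def using assms by (intro ball_cong refl) auto

lemma neg_def_block3_He:
  assumes T: "T \<in> carrier_mat p p" and X: "X \<in> carrier_mat p p" "X\<^sup>T = X"
    and G: "G \<in> carrier_mat p nw" and S: "S \<in> carrier_mat ny p"
  shows "neg_def (block3 (He T) G S\<^sup>T G\<^sup>T (- \<gamma> \<cdot>\<^sub>m 1\<^sub>m nw) Dw\<^sup>T S Dw (- \<gamma> \<cdot>\<^sub>m 1\<^sub>m ny) + corner Dw X) \<longleftrightarrow>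
    neg_on p (\<lambda>v1 v2 v3. 2 * (v1 \<bullet> (T *\<^sub>v v1 + G *\<^sub>v v2)) + 2 * (v3 \<bullet> (S *\<^sub>v v1))
      + 2 * (v3 \<bullet> (Dw *\<^sub>v v2)) - \<gamma> * (v2 \<bullet> v2) - \<gamma> * (v3 \<bullet> v3) + v1 \<bullet> (X *\<^sub>v v1))"
proof -
  have U: "He T + X \<in> carrier_mat p p" "(He T + X)\<^sup>T = He T + X"
    using T X He_symmetric[OF T] by (auto simp: transpose_add_dim)
  show ?thesis
    unfolding block3_add_corner[OF He_carrier[OF T] X(1) G S Dw]
      neg_def_block3[OF U G S Dw] neg_on_def
    by (intro ball_cong refl)
      (use T X G S in \<open>simp add: add_mult_mat_vec_dim scalar_prod_add_right_dim quadratic_form_He algebra_simps\<close>)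
qed

lemma add_corner_0:
  assumes "U \<in> carrier_mat p p" "G \<in> carrier_mat p nw" "S \<in> carrier_mat ny p"
  shows "block3 U G S\<^sup>T G\<^sup>T (- \<gamma> \<cdot>\<^sub>m 1\<^sub>m nw) Dw\<^sup>T S Dw (- \<gamma> \<cdot>\<^sub>m 1\<^sub>m ny) + corner Dw (0\<^sub>m p p)
    = block3 U G S\<^sup>T G\<^sup>T (- \<gamma> \<cdot>\<^sub>m 1\<^sub>m nw) Dw\<^sup>T S Dw (- \<gamma> \<cdot>\<^sub>m 1\<^sub>m ny)"
  using assms by (subst block3_add_corner[of _ p]) auto

lemma neg_def_block3_He':
  assumes T: "T \<in> carrier_mat p p" and G: "G \<in> carrier_mat p nw" and S: "S \<in> carrier_mat ny p"
  shows "neg_def (block3 (He T) G S\<^sup>T G\<^sup>T (- \<gamma> \<cdot>\<^sub>m 1\<^sub>m nw) Dw\<^sup>T S Dw (- \<gamma> \<cdot>\<^sub>m 1\<^sub>m ny)) \<longleftrightarrow>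
    neg_on p (\<lambda>v1 v2 v3. 2 * (v1 \<bullet> (T *\<^sub>v v1 + G *\<^sub>v v2)) + 2 * (v3 \<bullet> (S *\<^sub>v v1))
      + 2 * (v3 \<bullet> (Dw *\<^sub>v v2)) - \<gamma> * (v2 \<bullet> v2) - \<gamma> * (v3 \<bullet> v3))"
proof -
  have "(0\<^sub>m p p)\<^sup>T = (0\<^sub>m p p :: real mat)" by (rule eq_matI) auto
  moreover have "v \<bullet> (0\<^sub>m p p *\<^sub>v v) = 0" if "v \<in> carrier_vec p" for v :: "real vec"
    using that by (simp add: zero_mult_mat_vec_dim scalar_prod_right_zero[of _ p])
  ultimately show ?thesis
    using neg_def_block3_He[OF T zero_carrier_mat _ G S]
    unfolding add_corner_0[OF He_carrier[OF T] G S]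
    by (simp cong: neg_on_cong)
qed

text \<open>A strictly negative quadratic form in finite dimension leaves a uniform margin, obtained
  here from the lower bound for the negated block matrix. The margin \<open>e\<close> later pays for
  the cross terms in Finsler's argument.\<close>

lemma perf_upper_bound:
  assumes Q: "Q \<in> carrier_mat n n" and Z: "Z \<in> carrier_mat n n"
    and neg: "neg_on n (\<lambda>x. perf x (Q *\<^sub>v x) (Z *\<^sub>v x))"
  obtains e where "e > 0"
    "\<And>x v2 v3. x \<in> carrier_vec n \<Longrightarrow> v2 \<in> carrier_vec nw \<Longrightarrow> v3 \<in> carrier_vec ny \<Longrightarrow>
      perf x (Q *\<^sub>v x) (Z *\<^sub>v x) v2 v3 \<le> - e * (x \<bullet> x + v2 \<bullet> v2 + v3 \<bullet> v3)"
proof -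
  let ?T = "A * Q + B * Z" and ?S = "C * Q + D * Z"
  have T: "?T \<in> carrier_mat n n" "?S \<in> carrier_mat ny n" using Q Z by auto
  let ?G = "block3 (He ?T) Bw ?S\<^sup>T Bw\<^sup>T (- \<gamma> \<cdot>\<^sub>m 1\<^sub>m nw) Dw\<^sup>T ?S Dw (- \<gamma> \<cdot>\<^sub>m 1\<^sub>m ny)"
  note G = block3_carrier[OF He_carrier[OF T(1)], where nw=nw and ny=ny]
  have form: "x \<bullet> (He ?T *\<^sub>v x) + 2 * (x \<bullet> (Bw *\<^sub>v v2)) + 2 * (v3 \<bullet> (?S *\<^sub>v x)) + 2 * (v3 \<bullet> (Dw *\<^sub>v v2))
      - \<gamma> * (v2 \<bullet> v2) - \<gamma> * (v3 \<bullet> v3) = perf x (Q *\<^sub>v x) (Z *\<^sub>v x) v2 v3"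
    if "x \<in> carrier_vec n" "v2 \<in> carrier_vec nw" "v3 \<in> carrier_vec ny" for x v2 v3
    using that Q Z by (simp add: quadratic_form_He[OF T(1)] perf_def dim_simps)
  have "neg_def ?G"
    unfolding neg_def_block3[OF He_carrier[OF T(1)] He_symmetric[OF T(1)] Bw T(2) Dw]
    using neg unfolding neg_on_def by (metis form)
  hence "pos_def (- ?G)"
    unfolding neg_def_iff[OF G] pos_def_iff[OF uminus_carrier_mat[OF G]]
    by (simp add: transpose_uminus carrier_matD[OF G])
  from pos_def_lower_bound[OF uminus_carrier_mat[OF G] this] obtain e where e: "e > 0"
    "\<And>v. v \<in> carrier_vec (n + nw + ny) \<Longrightarrow> e * (v \<bullet> v) \<le> v \<bullet> (- ?G *\<^sub>v v)" by blast
  have "perf x (Q *\<^sub>v x) (Z *\<^sub>v x) v2 v3 \<le> - e * (x \<bullet> x + v2 \<bullet> v2 + v3 \<bullet> v3)"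
    if v: "x \<in> carrier_vec n" "v2 \<in> carrier_vec nw" "v3 \<in> carrier_vec ny" for x v2 v3
  proof -
    let ?v = "(x @\<^sub>v v2) @\<^sub>v v3"
    have vc: "?v \<in> carrier_vec (n + nw + ny)" using v by auto
    have "?v \<bullet> (- ?G *\<^sub>v ?v) = - (?v \<bullet> (?G *\<^sub>v ?v))"
      by (rule quadratic_form_uminus[OF G vc])
    moreover have "?v \<bullet> ?v = x \<bullet> x + v2 \<bullet> v2 + v3 \<bullet> v3"
      using v by (simp add: scalar_prod_append[of _ "n + nw" _ ny] scalar_prod_append[of _ n _ nw])
    ultimately show ?thesis 
      using e(2)[OF vc] form[OF v] quadratic_form_block3[OF He_carrier[OF T(1)] Bw T(2) Dw v, of \<gamma>] by simp
  qed
  thus ?thesis using that e(1) by blast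
qed

lemma analysis_lmi_iff:
  assumes P: "P \<in> carrier_mat n n" "P\<^sup>T = P" and K: "K \<in> carrier_mat n n"
  shows "neg_def (block3
          ((A + B * K)\<^sup>T * P + P * (A + B * K)) (P * Bw) ((C + D * K)\<^sup>T)
          (Bw\<^sup>T * P) (- \<gamma> \<cdot>\<^sub>m 1\<^sub>m (dim_col Dw)) (Dw\<^sup>T)
          (C + D * K) Dw (- \<gamma> \<cdot>\<^sub>m 1\<^sub>m (dim_row Dw))) \<longleftrightarrow>
    neg_on n (\<lambda>x. perf (P *\<^sub>v x) x (K *\<^sub>v x))"
proof -
  let ?T = "P * (A + B * K)"
  have T: "?T \<in> carrier_mat n n" "P * Bw \<in> carrier_mat n nw" "C + D * K \<in> carrier_mat ny n"
    using P K by auto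
  have "(A + B * K)\<^sup>T * P + ?T = He ?T"
    using P K unfolding He_def by (subst add_mat_comm_dim) (auto simp: transpose_mult_dim)
  moreover have "Bw\<^sup>T * P = (P * Bw)\<^sup>T" using P by (simp add: transpose_mult_dim)
  moreover have "2 * (x \<bullet> (?T *\<^sub>v x + (P * Bw) *\<^sub>v v2)) + 2 * (v3 \<bullet> ((C + D * K) *\<^sub>v x))
        + 2 * (v3 \<bullet> (Dw *\<^sub>v v2)) - \<gamma> * (v2 \<bullet> v2) - \<gamma> * (v3 \<bullet> v3) = perf (P *\<^sub>v x) x (K *\<^sub>v x) v2 v3"
    if "x \<in> carrier_vec n" "v2 \<in> carrier_vec nw" "v3 \<in> carrier_vec ny" for x v2 v3
  proof -
    have "(P *\<^sub>v x) \<bullet> y = x \<bullet> (P *\<^sub>v y)" if "dim_vec y = n" for y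
      using P that \<open>x \<in> carrier_vec n\<close> transpose_scalar_prod_dim[of P x y] by simp
    thus ?thesis using P K that
      by (simp add: perf_def dim_simps)
  qed
  ultimately show ?thesis
    using neg_def_block3_He'[OF T] by (simp cong: neg_on_cong)
qed

lemma synthesis_lmi_iff:
  assumes Q: "Q \<in> carrier_mat n n" "Q\<^sup>T = Q" and Z: "Z \<in> carrier_mat n n"
  shows "neg_def (block3
          (He (A * Q + B * Z)) Bw (Q * C\<^sup>T + Z\<^sup>T * D\<^sup>T)
          (Bw\<^sup>T) (- \<gamma> \<cdot>\<^sub>m 1\<^sub>m (dim_col Dw)) (Dw\<^sup>T)
          (C * Q + D * Z) Dw (- \<gamma> \<cdot>\<^sub>m 1\<^sub>m (dim_row Dw))) \<longleftrightarrow>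
    neg_on n (\<lambda>x. perf x (Q *\<^sub>v x) (Z *\<^sub>v x))"
proof -
  let ?T = "A * Q + B * Z"
  have T: "?T \<in> carrier_mat n n" "Bw \<in> carrier_mat n nw" "C * Q + D * Z \<in> carrier_mat ny n"
    using Q Z by auto
  have "Q * C\<^sup>T + Z\<^sup>T * D\<^sup>T = (C * Q + D * Z)\<^sup>T"
    using Q Z by (simp add: dim_simps)
  moreover have "2 * (x \<bullet> (?T *\<^sub>v x + Bw *\<^sub>v v2)) + 2 * (v3 \<bullet> ((C * Q + D * Z) *\<^sub>v x))
        + 2 * (v3 \<bullet> (Dw *\<^sub>v v2)) - \<gamma> * (v2 \<bullet> v2) - \<gamma> * (v3 \<bullet> v3) = perf x (Q *\<^sub>v x) (Z *\<^sub>v x) v2 v3"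
    if "x \<in> carrier_vec n" "v2 \<in> carrier_vec nw" "v3 \<in> carrier_vec ny" for x v2 v3
    using Q Z that by (simp add: perf_def dim_simps)
  ultimately show ?thesis
    using neg_def_block3_He'[OF T] by (simp cong: neg_on_cong)
qed

end

text \<open>The part of the lift that does not mention cliques. The left inverse makes
  \<open>E * E_pinv E\<close> idempotent, and together with symmetry this makes it the orthogonal
  projection onto the range of \<open>E\<close>.\<close>

locale lifted_plant = plant +
  fixes m :: nat and E :: "real mat"
  assumes E: "E \<in> carrier_mat m n" and pinv: "E_pinv E \<in> carrier_mat n m"
    and pinv_E: "E_pinv E * E = 1\<^sub>m n" and E_pinv_symmetric: "(E * E_pinv E)\<^sup>T = E * E_pinv E"
begin

abbreviation "F \<equiv> E_pinv E"

abbreviation "M \<equiv> M_mat E"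

lemmas lift_dims [simp] = carrier_matD[OF E] carrier_matD[OF pinv]

lemmas lift_carriers [simp] = E pinv

lemma M: "M \<in> carrier_mat m m" unfolding M_mat_def by (auto intro: minus_carrier_mat)

lemma M_dims [simp]: "dim_row M = m" "dim_col M = m" using M by auto

lemma M_symmetric: "M\<^sup>T = M"
  unfolding M_mat_def using E_pinv_symmetric by (simp add: transpose_minus_dim)

lemma pinv_E_vec: "x \<in> carrier_vec n \<Longrightarrow> F *\<^sub>v (E *\<^sub>v x) = x"
  using mult_mat_vec_assoc_dim[of F E x] by (simp add: pinv_E)

lemma E_injective: "x \<in> carrier_vec n \<Longrightarrow> E *\<^sub>v x = 0\<^sub>v m \<Longrightarrow> x = 0\<^sub>v n"
  using pinv_E_vec[of x] by (simp add: mult_mat_zero_vec_dim)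

lemma M_vec: "v \<in> carrier_vec m \<Longrightarrow> M *\<^sub>v v = v - E *\<^sub>v (F *\<^sub>v v)"
  unfolding M_mat_def by (subst minus_mult_distrib_mat_vec[of _ m m]) (auto simp: mult_mat_vec_assoc_dim)

lemma M_E_vec: "x \<in> carrier_vec n \<Longrightarrow> M *\<^sub>v (E *\<^sub>v x) = 0\<^sub>v m"
  by (subst M_vec) (auto simp: pinv_E_vec intro: carrier_vecI)

lemma M_M_vec:
  assumes v: "v \<in> carrier_vec m"
  shows "M *\<^sub>v (M *\<^sub>v v) = M *\<^sub>v v"
proof -
  have "M *\<^sub>v (v - E *\<^sub>v (F *\<^sub>v v)) = M *\<^sub>v v - M *\<^sub>v (E *\<^sub>v (F *\<^sub>v v))"
    using v by (intro mult_minus_distrib_mat_vec[OF M]) (auto intro: carrier_vecI)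
  also have "M *\<^sub>v (E *\<^sub>v (F *\<^sub>v v)) = 0\<^sub>v m" by (intro M_E_vec carrier_vecI) simp
  also have "M *\<^sub>v v - 0\<^sub>v m = M *\<^sub>v v" by (intro eq_vecI) auto
  finally show ?thesis using M_vec[OF v] by simp
qed

text \<open>Symmetry and idempotence of \<open>M\<close>. In this way every quadratic form in
  \<open>M\<close> becomes a squared norm, to which Young's inequality applies.\<close>

lemma scalar_prod_M:
  assumes "u \<in> carrier_vec m" "v \<in> carrier_vec m"
  shows "u \<bullet> (M *\<^sub>v v) = (M *\<^sub>v u) \<bullet> (M *\<^sub>v v)"
  using assms M_M_vec[of v] transpose_scalar_prod_dim[of M u "M *\<^sub>v v"] M_symmetric by simp

text \<open>The factor \<open>E\<close> to the left of the lifted system matrices moves across the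
  scalar product and becomes \<open>E\<^sup>T *\<^sub>v v\<close>; the factor \<open>F\<close> to
  their right acts on \<open>Qt v\<close> and \<open>Zt v\<close>. What is left is the form of the
  original plant.\<close>

lemma lifted_lmi_iff:
  assumes Qt: "Qt \<in> carrier_mat m m" "Qt\<^sup>T = Qt" and Zt: "Zt \<in> carrier_mat m m"
    and X: "X \<in> carrier_mat m m" "X\<^sup>T = X"
  shows "neg_def (Gamma E A B Bw C D Dw \<gamma> Qt Zt + corner Dw X) \<longleftrightarrow>
    neg_on m (\<lambda>v v2 v3. perf (E\<^sup>T *\<^sub>v v) (F *\<^sub>v (Qt *\<^sub>v v)) (F *\<^sub>v (Zt *\<^sub>v v)) v2 v3 + v \<bullet> (X *\<^sub>v v))"
proof -
  let ?T = "E * A * F * Qt + E * B * F * Zt" and ?S = "C * F * Qt + D * F * Zt"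
  have T: "?T \<in> carrier_mat m m" using Qt Zt by auto
  have S: "?S \<in> carrier_mat ny m" using Qt Zt by auto
  have G: "E * Bw \<in> carrier_mat m nw" by auto
  have "Qt * (C * F)\<^sup>T + Zt\<^sup>T * (D * F)\<^sup>T = ?S\<^sup>T"
    using Qt Zt by (simp add: dim_simps)
  moreover have "2 * (v \<bullet> (?T *\<^sub>v v + (E * Bw) *\<^sub>v v2)) + 2 * (v3 \<bullet> (?S *\<^sub>v v))
        + 2 * (v3 \<bullet> (Dw *\<^sub>v v2)) - \<gamma> * (v2 \<bullet> v2) - \<gamma> * (v3 \<bullet> v3) + v \<bullet> (X *\<^sub>v v)
      = perf (E\<^sup>T *\<^sub>v v) (F *\<^sub>v (Qt *\<^sub>v v)) (F *\<^sub>v (Zt *\<^sub>v v)) v2 v3 + v \<bullet> (X *\<^sub>v v)"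
    if "v \<in> carrier_vec m" "v2 \<in> carrier_vec nw" "v3 \<in> carrier_vec ny" for v v2 v3
    using Qt Zt that by (simp add: perf_def dim_simps transpose_scalar_prod_dim)
  ultimately show ?thesis
    using neg_def_block3_He[OF T X G S] by (simp add: Gamma_def Let_def cong: neg_on_cong)
qed

lemma lifted_imp_analysis:
  assumes Qt: "Qt \<in> carrier_mat m m" "pos_def Qt" and Zt: "Zt \<in> carrier_mat m m"
    and lmi: "neg_def (Gamma E A B Bw C D Dw \<gamma> Qt Zt + corner Dw (\<rho> \<cdot>\<^sub>m (Qt * M * Qt)))"
  defines "P \<equiv> E\<^sup>T * minv Qt * E" and "K \<equiv> F * (Zt * minv Qt) * E"
  shows "pos_def P"
    and "neg_on n (\<lambda>x. perf (P *\<^sub>v x) x (K *\<^sub>v x))"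
proof -
  note inv = pos_def_minv[OF Qt]
  have sym: "Qt\<^sup>T = Qt" using Qt by (simp add: pos_def_iff)
  show "pos_def P" unfolding P_def
    using inv E_injective by (intro pos_def_congruence[of _ m]) auto
  let ?X = "\<rho> \<cdot>\<^sub>m (Qt * M * Qt)"
  have X: "?X \<in> carrier_mat m m" using Qt M by auto
  have "(Qt * M * Qt)\<^sup>T = Qt * M * Qt"
    using Qt M sym M_symmetric by (simp add: dim_simps)
  hence "?X\<^sup>T = ?X" by (simp only: transpose_smult_mat)
  hence neg: "neg_on m (\<lambda>v v2 v3. perf (E\<^sup>T *\<^sub>v v) (F *\<^sub>v (Qt *\<^sub>v v)) (F *\<^sub>v (Zt *\<^sub>v v)) v2 v3 + v \<bullet> (?X *\<^sub>v v))"
    using lmi lifted_lmi_iff[OF Qt(1) sym Zt X] by simp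
  show "neg_on n (\<lambda>x. perf (P *\<^sub>v x) x (K *\<^sub>v x))"
    unfolding neg_on_def
  proof (intro ballI impI)
    fix x v2 v3 :: "real vec" assume x: "x \<in> carrier_vec n" and v: "v2 \<in> carrier_vec nw" "v3 \<in> carrier_vec ny"
      and nz: "\<not> (x = 0\<^sub>v n \<and> v2 = 0\<^sub>v nw \<and> v3 = 0\<^sub>v ny)"
    define v1 where "v1 = minv Qt *\<^sub>v (E *\<^sub>v x)"
    have v1: "v1 \<in> carrier_vec m" unfolding v1_def using inv(1) by (intro carrier_vecI) simp
    have Q1: "Qt *\<^sub>v v1 = E *\<^sub>v x"
      using inv Qt x mult_mat_vec_assoc_dim[of Qt "minv Qt" "E *\<^sub>v x"]
      by (simp add: v1_def one_mult_mat_vec_dim)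
    \<comment> \<open>Injectivity of \<open>E\<close> takes nonzero triples to nonzero triples, so
      the strict inequality is available at \<open>v1\<close>.\<close>
    have "x = 0\<^sub>v n" if "v1 = 0\<^sub>v m"
      using Q1 that E_injective[OF x] Qt by (simp add: mult_mat_zero_vec_dim)
    hence "\<not> (v1 = 0\<^sub>v m \<and> v2 = 0\<^sub>v nw \<and> v3 = 0\<^sub>v ny)" using nz by blast
    hence *: "perf (E\<^sup>T *\<^sub>v v1) (F *\<^sub>v (Qt *\<^sub>v v1)) (F *\<^sub>v (Zt *\<^sub>v v1)) v2 v3 + v1 \<bullet> (?X *\<^sub>v v1) < 0"
      using neg v1 v unfolding neg_on_def by blast
    have "?X *\<^sub>v v1 = \<rho> \<cdot>\<^sub>v (Qt *\<^sub>v (M *\<^sub>v (E *\<^sub>v x)))"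
      using Qt v1 by (simp add: smult_mult_mat_vec_dim mult_mat_vec_assoc_dim Q1)
    hence "v1 \<bullet> (?X *\<^sub>v v1) = 0" using Qt v1 x by (simp add: M_E_vec mult_mat_zero_vec_dim scalar_prod_right_zero[of _ m])
    moreover have "E\<^sup>T *\<^sub>v v1 = P *\<^sub>v x" "F *\<^sub>v (Zt *\<^sub>v v1) = K *\<^sub>v x"
      using inv Zt x by (simp_all add: P_def K_def v1_def dim_simps)
    ultimately show "perf (P *\<^sub>v x) x (K *\<^sub>v x) v2 v3 < 0"
      using * Q1 pinv_E_vec[OF x] by simp
  qed
qed

lemma relaxed_lmi_imp_lifted:
  assumes Qt: "Qt \<in> carrier_mat m m" "Qt\<^sup>T = Qt" and Zt: "Zt \<in> carrier_mat m m"
    and eta: "\<eta> > 0" "pos_semidef (Qt * M + M * Qt - \<eta> \<cdot>\<^sub>m M)"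
    and lmi: "neg_def (Gamma E A B Bw C D Dw \<gamma> Qt Zt + corner Dw (\<rho> \<cdot>\<^sub>m M))"
  shows "\<exists>\<rho>. neg_def (Gamma E A B Bw C D Dw \<gamma> Qt Zt + corner Dw (\<rho> \<cdot>\<^sub>m (Qt * M * Qt)))"
proof -
  \<comment> \<open>\<open>\<eta> |Mv|\<^sup>2 \<le> 2 (Mv) \<bullet> (M Qt v)\<close>, and Young's inequality splits the right-hand side\<close>
  define \<rho>' where "\<rho>' = - \<bar>\<rho>\<bar> * (4 / \<eta>\<^sup>2)"
  let ?X = "\<rho>' \<cdot>\<^sub>m (Qt * M * Qt)" and ?f = "\<lambda>v. perf (E\<^sup>T *\<^sub>v v) (F *\<^sub>v (Qt *\<^sub>v v)) (F *\<^sub>v (Zt *\<^sub>v v))"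
  have X: "?X \<in> carrier_mat m m" using Qt M by auto
  have "(Qt * M * Qt)\<^sup>T = Qt * M * Qt"
    using Qt M M_symmetric by (simp add: dim_simps)
  hence X': "?X\<^sup>T = ?X" by (simp only: transpose_smult_mat)
  have Y: "\<rho> \<cdot>\<^sub>m M \<in> carrier_mat m m" "(\<rho> \<cdot>\<^sub>m M)\<^sup>T = \<rho> \<cdot>\<^sub>m M"
    using M by (simp_all add: transpose_smult_mat M_symmetric)
  have neg: "neg_on m (\<lambda>v v2 v3. ?f v v2 v3 + v \<bullet> ((\<rho> \<cdot>\<^sub>m M) *\<^sub>v v))"
    using lmi lifted_lmi_iff[OF Qt Zt Y] by simp
  have bound: "v \<bullet> (?X *\<^sub>v v) \<le> v \<bullet> ((\<rho> \<cdot>\<^sub>m M) *\<^sub>v v)" if v: "v \<in> carrier_vec m" for v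
  proof -
    define a b where "a = M *\<^sub>v v" and "b = M *\<^sub>v (Qt *\<^sub>v v)"
    have ab: "dim_vec a = m" "dim_vec b = m" by (simp_all add: a_def b_def)
    have Qv: "Qt *\<^sub>v v \<in> carrier_vec m" using Qt v by auto
    have adj: "v \<bullet> (Qt *\<^sub>v w) = (Qt *\<^sub>v v) \<bullet> w" if "dim_vec w = m" for w
      using Qt v that transpose_scalar_prod_dim[of Qt v w] by simp
    have 1: "v \<bullet> (M *\<^sub>v v) = a \<bullet> a" using scalar_prod_M[OF v v] by (simp add: a_def)
    have 2: "v \<bullet> (Qt *\<^sub>v (M *\<^sub>v v)) = b \<bullet> a"
      using scalar_prod_M[OF Qv v] by (simp add: a_def b_def adj)
    have 3: "v \<bullet> (M *\<^sub>v (Qt *\<^sub>v v)) = a \<bullet> b"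
      using scalar_prod_M[OF v Qv] by (simp add: a_def b_def)
    have 4: "v \<bullet> (Qt *\<^sub>v (M *\<^sub>v (Qt *\<^sub>v v))) = b \<bullet> b"
      using scalar_prod_M[OF Qv Qv] by (simp add: b_def adj)
    have S: "Qt * M + M * Qt - \<eta> \<cdot>\<^sub>m M \<in> carrier_mat m m" by (rule carrier_matI) (use Qt in auto)
    have "(Qt * M + M * Qt - \<eta> \<cdot>\<^sub>m M) *\<^sub>v v
        = Qt *\<^sub>v (M *\<^sub>v v) + M *\<^sub>v (Qt *\<^sub>v v) - \<eta> \<cdot>\<^sub>v (M *\<^sub>v v)"
      using Qt M v by (subst minus_mult_distrib_mat_vec[of _ m m])
        (auto simp: dim_simps smult_mult_mat_vec_dim)
    moreover have "v \<bullet> (Qt *\<^sub>v (M *\<^sub>v v) + M *\<^sub>v (Qt *\<^sub>v v) - \<eta> \<cdot>\<^sub>v (M *\<^sub>v v)) = b \<bullet> a + a \<bullet> b - \<eta> * (a \<bullet> a)"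
      using Qt M v by (subst scalar_prod_minus_distrib[of _ m])
        (auto simp: scalar_prod_add_right_dim 1 2 3 intro: carrier_vecI)
    ultimately have "0 \<le> b \<bullet> a + a \<bullet> b - \<eta> * (a \<bullet> a)"
      using eta(2) v pos_semidef_iff[OF S] by metis
    moreover have "b \<bullet> a = a \<bullet> b" using ab by (intro scalar_prod_comm_dim) simp
    \<comment> \<open>The weight \<open>\<eta>/2\<close> gives away half of
      \<open>\<eta> * (a \<bullet> a)\<close>; solving for the other half produces the constant
      \<open>4 / \<eta>\<^sup>2\<close>.\<close>
    moreover have "2 * (a \<bullet> b) \<le> (\<eta>/2) * (a \<bullet> a) + (b \<bullet> b) / (\<eta>/2)"
      using ab eta by (intro scalar_prod_young) auto
    ultimately have "(\<eta>/2) * (a \<bullet> a) \<le> (b \<bullet> b) / (\<eta>/2)" by linarith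
    hence *: "a \<bullet> a \<le> (4 / \<eta>\<^sup>2) * (b \<bullet> b)" using eta by (simp add: field_simps power2_eq_square)
    \<comment> \<open>The sign of \<rho> is unknown. Passing to \<open>- \<bar>\<rho>\<bar>\<close>
      only lowers the penalty and yields a nonpositive factor, under which \<open>*\<close> points
      in the required direction.\<close>
    have "\<rho>' * (b \<bullet> b) = - (\<bar>\<rho>\<bar> * ((4 / \<eta>\<^sup>2) * (b \<bullet> b)))" by (simp add: \<rho>'_def)
    also have "\<dots> \<le> - (\<bar>\<rho>\<bar> * (a \<bullet> a))" using mult_left_mono[OF *, of "\<bar>\<rho>\<bar>"] by simp
    also have "\<dots> \<le> \<rho> * (a \<bullet> a)"
      using mult_right_mono[of "- \<bar>\<rho>\<bar>" \<rho>, OF _ scalar_prod_self_nonneg[of a]] by simp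
    finally have "\<rho>' * (b \<bullet> b) \<le> \<rho> * (a \<bullet> a)" .
    moreover have "v \<bullet> (?X *\<^sub>v v) = \<rho>' * (b \<bullet> b)"
      using Qt v by (simp add: smult_mult_mat_vec_dim mult_mat_vec_assoc_dim 4)
    moreover have "v \<bullet> ((\<rho> \<cdot>\<^sub>m M) *\<^sub>v v) = \<rho> * (a \<bullet> a)"
      using v by (simp add: smult_mult_mat_vec_dim 1)
    ultimately show ?thesis by simp
  qed
  have "neg_on m (\<lambda>v v2 v3. ?f v v2 v3 + v \<bullet> (?X *\<^sub>v v))"
    unfolding neg_on_def
  proof (intro ballI impI)
    fix v v2 v3 :: "real vec" assume *: "v \<in> carrier_vec m" "v2 \<in> carrier_vec nw" "v3 \<in> carrier_vec ny"
      "\<not> (v = 0\<^sub>v m \<and> v2 = 0\<^sub>v nw \<and> v3 = 0\<^sub>v ny)"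
    hence "?f v v2 v3 + v \<bullet> ((\<rho> \<cdot>\<^sub>m M) *\<^sub>v v) < 0" using neg unfolding neg_on_def by blast
    thus "?f v v2 v3 + v \<bullet> (?X *\<^sub>v v) < 0" using bound[OF *(1)] by linarith
  qed
  thus ?thesis using lifted_lmi_iff[OF Qt Zt X X'] by blast
qed

text \<open>Split \<open>v\<close> into \<open>F\<^sup>T a\<close> with
  \<open>a = E\<^sup>T v\<close> and \<open>b = M v\<close>. The first argument of
  \<open>perf\<close> is \<open>a\<close> and does not see \<open>b\<close>, so \<open>perf\<close>
  contributes no term quadratic in \<open>b\<close>, only cross terms of \<open>b\<close> with
  \<open>a\<close> and with \<open>v3\<close>. The margin in \<open>a\<close> and \<open>v3\<close>
  and the penalty in \<open>b\<close> absorb these. Commutation supplies the semidefinite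
  constraint.\<close>

lemma synthesis_imp_relaxed_lmi:
  assumes Q: "Q \<in> carrier_mat n n" "Q\<^sup>T = Q" and Z: "Z \<in> carrier_mat n n"
    and Qt: "Qt \<in> carrier_mat m m" "pos_def Qt" and Zt: "Zt \<in> carrier_mat m m"
    and FQ: "F * Qt * F\<^sup>T = Q" and FZ: "F * Zt * F\<^sup>T = Z"
    and commute: "Qt * M = M * Qt"
    and neg: "neg_on n (\<lambda>x. perf x (Q *\<^sub>v x) (Z *\<^sub>v x))"
  shows "\<exists>\<rho> \<eta>. \<eta> > 0 \<and> pos_semidef (Qt * M + M * Qt - \<eta> \<cdot>\<^sub>m M) \<and>
    neg_def (Gamma E A B Bw C D Dw \<gamma> Qt Zt + corner Dw (\<rho> \<cdot>\<^sub>m M))"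
proof -
  have Qt_sym: "Qt\<^sup>T = Qt" using Qt by (simp add: pos_def_iff)
  obtain e where e: "e > 0" and perf_le: "\<And>x v2 v3. x \<in> carrier_vec n \<Longrightarrow> v2 \<in> carrier_vec nw \<Longrightarrow> v3 \<in> carrier_vec ny \<Longrightarrow>
      perf x (Q *\<^sub>v x) (Z *\<^sub>v x) v2 v3 \<le> - e * (x \<bullet> x + v2 \<bullet> v2 + v3 \<bullet> v3)"
    using perf_upper_bound[OF Q(1) Z neg] by blast
  define L where "L = A * F * Qt + B * F * Zt"
  define S where "S = C * F * Qt + D * F * Zt"
  have LS: "L \<in> carrier_mat n m" "S \<in> carrier_mat ny m" using Qt Zt by (auto simp: L_def S_def)
  obtain cL where cL: "cL > 0" "\<And>v. v \<in> carrier_vec m \<Longrightarrow> (L *\<^sub>v v) \<bullet> (L *\<^sub>v v) \<le> cL * (v \<bullet> v)"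
    using mult_mat_vec_bounded[OF LS(1)] by blast
  obtain cS where cS: "cS > 0" "\<And>v. v \<in> carrier_vec m \<Longrightarrow> (S *\<^sub>v v) \<bullet> (S *\<^sub>v v) \<le> cS * (v \<bullet> v)"
    using mult_mat_vec_bounded[OF LS(2)] by blast
  \<comment> \<open>cancels the two Young remainders below and leaves \<open>- |b|\<^sup>2\<close>\<close>
  define \<rho> where "\<rho> = - (2 / e * (cL + cS) + 1)"
  have Y: "\<rho> \<cdot>\<^sub>m M \<in> carrier_mat m m" "(\<rho> \<cdot>\<^sub>m M)\<^sup>T = \<rho> \<cdot>\<^sub>m M"
    using M by (simp_all add: transpose_smult_mat M_symmetric)
  have "neg_on m (\<lambda>v v2 v3. perf (E\<^sup>T *\<^sub>v v) (F *\<^sub>v (Qt *\<^sub>v v)) (F *\<^sub>v (Zt *\<^sub>v v)) v2 v3 + v \<bullet> ((\<rho> \<cdot>\<^sub>m M) *\<^sub>v v))"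
    unfolding neg_on_def
  proof (intro ballI impI)
    fix v v2 v3 :: "real vec" assume v: "v \<in> carrier_vec m" "v2 \<in> carrier_vec nw" "v3 \<in> carrier_vec ny"
      and nz: "\<not> (v = 0\<^sub>v m \<and> v2 = 0\<^sub>v nw \<and> v3 = 0\<^sub>v ny)"
    define a b where "a = E\<^sup>T *\<^sub>v v" and "b = M *\<^sub>v v"
    have a: "a \<in> carrier_vec n" and b: "b \<in> carrier_vec m"
      unfolding a_def b_def by (intro carrier_vecI; simp)+
    have "F\<^sup>T *\<^sub>v a = (E * F)\<^sup>T *\<^sub>v v" using v by (simp add: a_def dim_simps)
    also have "\<dots> = E *\<^sub>v (F *\<^sub>v v)" using v by (simp add: E_pinv_symmetric mult_mat_vec_assoc_dim)
    \<comment> \<open>By symmetry of \<open>E * F\<close>, the vector \<open>F\<^sup>T a\<close> is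
      the component of \<open>v\<close> in the range of \<open>E\<close>, and \<open>b\<close> is
      the orthogonal one.\<close>
    finally have v_eq: "v = F\<^sup>T *\<^sub>v a + b" using v by (intro eq_vecI) (auto simp: b_def M_vec)
    have "F *\<^sub>v (Qt *\<^sub>v v) = (F * Qt * F\<^sup>T) *\<^sub>v a + F *\<^sub>v (Qt *\<^sub>v b)"
      using a b Qt unfolding v_eq by (simp add: dim_simps)
    moreover have "F *\<^sub>v (Zt *\<^sub>v v) = (F * Zt * F\<^sup>T) *\<^sub>v a + F *\<^sub>v (Zt *\<^sub>v b)"
      using a b Zt unfolding v_eq by (simp add: dim_simps)
    \<comment> \<open>For fixed \<open>s\<close>, \<open>v2\<close>, \<open>v3\<close> the function
      \<open>perf\<close> is affine in \<open>(u, w)\<close>, so the contribution of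
      \<open>b\<close> separates.\<close>
    ultimately have "perf a (F *\<^sub>v (Qt *\<^sub>v v)) (F *\<^sub>v (Zt *\<^sub>v v)) v2 v3
        = perf a (Q *\<^sub>v a) (Z *\<^sub>v a) v2 v3 + 2 * (a \<bullet> (L *\<^sub>v b)) + 2 * (v3 \<bullet> (S *\<^sub>v b))"
      using a b v Q Z Qt Zt by (simp add: perf_def L_def S_def dim_simps FQ FZ algebra_simps)
    moreover have "v \<bullet> ((\<rho> \<cdot>\<^sub>m M) *\<^sub>v v) = \<rho> * (b \<bullet> b)"
      using v scalar_prod_M[OF v(1) v(1)] by (simp add: smult_mult_mat_vec_dim b_def)
    \<comment> \<open>The weight \<open>e / 2\<close> spends half of the margin in \<open>a\<close>;
      the other cross term does the same in \<open>v3\<close>. Half of each survives for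
      strictness.\<close>
    moreover have "2 * (a \<bullet> (L *\<^sub>v b)) \<le> e / 2 * (a \<bullet> a) + (2 / e) * (cL * (b \<bullet> b))"
    proof -
      have "2 * (a \<bullet> (L *\<^sub>v b)) \<le> e / 2 * (a \<bullet> a) + (L *\<^sub>v b) \<bullet> (L *\<^sub>v b) / (e / 2)"
        using a LS e by (intro scalar_prod_young) auto
      also have "(L *\<^sub>v b) \<bullet> (L *\<^sub>v b) / (e / 2) \<le> cL * (b \<bullet> b) / (e / 2)"
        using e cL(2)[OF b] by (intro divide_right_mono) auto
      finally show ?thesis by simp
    qed
    moreover have "2 * (v3 \<bullet> (S *\<^sub>v b)) \<le> e / 2 * (v3 \<bullet> v3) + (2 / e) * (cS * (b \<bullet> b))"
    proof -
      have "2 * (v3 \<bullet> (S *\<^sub>v b)) \<le> e / 2 * (v3 \<bullet> v3) + (S *\<^sub>v b) \<bullet> (S *\<^sub>v b) / (e / 2)"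
        using v LS e by (intro scalar_prod_young) auto
      also have "(S *\<^sub>v b) \<bullet> (S *\<^sub>v b) / (e / 2) \<le> cS * (b \<bullet> b) / (e / 2)"
        using e cS(2)[OF b] by (intro divide_right_mono) auto
      finally show ?thesis by simp
    qed
    moreover have "\<rho> * (b \<bullet> b) = - ((2 / e) * (cL * (b \<bullet> b))) - (2 / e) * (cS * (b \<bullet> b)) - b \<bullet> b"
      by (simp add: \<rho>_def algebra_simps add_divide_distrib)
    moreover have "- e * (a \<bullet> a + v2 \<bullet> v2 + v3 \<bullet> v3) = - e * (a \<bullet> a) - e * (v2 \<bullet> v2) - e * (v3 \<bullet> v3)"
      by (simp add: algebra_simps)
    ultimately have "perf a (F *\<^sub>v (Qt *\<^sub>v v)) (F *\<^sub>v (Zt *\<^sub>v v)) v2 v3 + v \<bullet> ((\<rho> \<cdot>\<^sub>m M) *\<^sub>v v)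
        \<le> - (e / 2 * (a \<bullet> a)) - e * (v2 \<bullet> v2) - e / 2 * (v3 \<bullet> v3) - b \<bullet> b"
      using perf_le[OF a v(2,3)] by linarith
    also have "\<dots> < 0"
    proof -
      have pos: "a \<bullet> a \<ge> 0" "v2 \<bullet> v2 \<ge> 0" "v3 \<bullet> v3 \<ge> 0" "b \<bullet> b \<ge> 0"
        by (rule scalar_prod_self_nonneg)+
      have "\<not> (a \<bullet> a = 0 \<and> v2 \<bullet> v2 = 0 \<and> v3 \<bullet> v3 = 0 \<and> b \<bullet> b = 0)"
      proof
        assume *: "a \<bullet> a = 0 \<and> v2 \<bullet> v2 = 0 \<and> v3 \<bullet> v3 = 0 \<and> b \<bullet> b = 0"
        hence "a = 0\<^sub>v n" "b = 0\<^sub>v m" "v2 = 0\<^sub>v nw" "v3 = 0\<^sub>v ny"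
          using a b v scalar_prod_self_eq_0 by blast+
        thus False using nz v_eq by (simp add: mult_mat_zero_vec_dim)
      qed
      hence "a \<bullet> a > 0 \<or> v2 \<bullet> v2 > 0 \<or> v3 \<bullet> v3 > 0 \<or> b \<bullet> b > 0" using pos by linarith
      hence "e / 2 * (a \<bullet> a) > 0 \<or> e * (v2 \<bullet> v2) > 0 \<or> e / 2 * (v3 \<bullet> v3) > 0 \<or> b \<bullet> b > 0"
        using e by auto
      moreover have "e / 2 * (a \<bullet> a) \<ge> 0" "e * (v2 \<bullet> v2) \<ge> 0" "e / 2 * (v3 \<bullet> v3) \<ge> 0"
        using e pos by auto
      ultimately show ?thesis using pos by linarith
    qed
    finally show "perf (E\<^sup>T *\<^sub>v v) (F *\<^sub>v (Qt *\<^sub>v v)) (F *\<^sub>v (Zt *\<^sub>v v)) v2 v3 + v \<bullet> ((\<rho> \<cdot>\<^sub>m M) *\<^sub>v v) < 0"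
      by (simp add: a_def)
  qed
  hence lmi: "neg_def (Gamma E A B Bw C D Dw \<gamma> Qt Zt + corner Dw (\<rho> \<cdot>\<^sub>m M))"
    using lifted_lmi_iff[OF Qt(1) Qt_sym Zt Y] by blast
  obtain d where d: "d > 0" "\<And>v. v \<in> carrier_vec m \<Longrightarrow> d * (v \<bullet> v) \<le> v \<bullet> (Qt *\<^sub>v v)"
    using pos_def_lower_bound[OF Qt] by blast
  \<comment> \<open>By commutation the form of \<open>Qt * M + M * Qt\<close> at \<open>v\<close> is
    \<open>2 * (b \<bullet> (Qt *\<^sub>v b))\<close> with \<open>b = M v\<close>, and
    \<open>d\<close> bounds \<open>Qt\<close> from below. Hence
    \<open>\<eta> = 2 * d\<close>.\<close>
  let ?S = "Qt * M + M * Qt - (2 * d) \<cdot>\<^sub>m M"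
  have S: "?S \<in> carrier_mat m m" by (rule carrier_matI) (use Qt in auto)
  have "pos_semidef ?S"
    unfolding pos_semidef_iff[OF S]
  proof (intro conjI ballI)
    have "(Qt * M)\<^sup>T = M * Qt" "(M * Qt)\<^sup>T = Qt * M"
      using Qt Qt_sym M_symmetric by (simp_all add: transpose_mult_dim)
    thus "?S\<^sup>T = ?S"
      using Qt by (simp add: transpose_minus_dim transpose_add_dim transpose_smult_mat M_symmetric commute)
    fix v :: "real vec" assume v: "v \<in> carrier_vec m"
    define b where "b = M *\<^sub>v v"
    have b: "b \<in> carrier_vec m" unfolding b_def by (intro carrier_vecI) simp
    have comm: "Qt *\<^sub>v (M *\<^sub>v w) = M *\<^sub>v (Qt *\<^sub>v w)" if "w \<in> carrier_vec m" for w
      using that Qt arg_cong[OF commute, of "\<lambda>X. X *\<^sub>v w"] by (simp add: mult_mat_vec_assoc_dim)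
    have "v \<bullet> (M *\<^sub>v (Qt *\<^sub>v b)) = b \<bullet> (Qt *\<^sub>v b)"
      using v Qt M_symmetric transpose_scalar_prod_dim[of M v "Qt *\<^sub>v b"] by (simp add: b_def)
    moreover have "Qt *\<^sub>v b = M *\<^sub>v (Qt *\<^sub>v b)" "M *\<^sub>v (Qt *\<^sub>v v) = Qt *\<^sub>v b"
      using comm[OF b] comm[OF v] v by (simp_all add: b_def M_M_vec)
    ultimately have 1: "v \<bullet> (Qt *\<^sub>v b) = b \<bullet> (Qt *\<^sub>v b)" "M *\<^sub>v (Qt *\<^sub>v v) = Qt *\<^sub>v b" by simp_all
    have "?S *\<^sub>v v = Qt *\<^sub>v b + Qt *\<^sub>v b - (2 * d) \<cdot>\<^sub>v b"
      using Qt M v by (subst minus_mult_distrib_mat_vec[of _ m m])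
        (auto simp: dim_simps smult_mult_mat_vec_dim 1(2) b_def[symmetric])
    hence "v \<bullet> (?S *\<^sub>v v) = v \<bullet> (Qt *\<^sub>v b + Qt *\<^sub>v b) - v \<bullet> ((2 * d) \<cdot>\<^sub>v b)"
      using Qt v b by (simp add: scalar_prod_minus_distrib[of _ m])
    also have "\<dots> = 2 * (b \<bullet> (Qt *\<^sub>v b)) - 2 * d * (b \<bullet> b)"
      using Qt v b scalar_prod_M[OF v v] by (simp add: scalar_prod_add_right_dim 1 b_def[symmetric])
    finally show "v \<bullet> (?S *\<^sub>v v) \<ge> 0" using d(2)[OF b] by simp
  qed
  thus ?thesis using lmi d(1) by (intro exI[of _ \<rho>] exI[of _ "2 * d"]) simp
qed

text \<open>For square \<open>E\<close> the pseudoinverse is the inverse, so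
  \<open>P = E\<^sup>T * minv Qt * E\<close> can be solved for \<open>Qt\<close>, which gives
  \<open>E * minv P * E\<^sup>T\<close>. The choice of \<open>Zt\<close> makes
  \<open>Zt * minv Qt\<close> equal to \<open>E * K * F\<close>. As \<open>M\<close> vanishes, the
  values 1 for \<eta> and 0 for \<rho> are arbitrary.\<close>

lemma analysis_imp_relaxed_lmi_square:
  assumes square: "m = n" and P: "P \<in> carrier_mat n n" "pos_def P" and K: "K \<in> carrier_mat n n"
    and neg: "neg_on n (\<lambda>x. perf (P *\<^sub>v x) x (K *\<^sub>v x))"
  obtains Qt Zt where "Qt \<in> carrier_mat m m" "pos_def Qt" "Zt \<in> carrier_mat m m"
    "F * (Zt * minv Qt) * E = K"
    "pos_semidef (Qt * M + M * Qt - 1 \<cdot>\<^sub>m M)"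
    "neg_def (Gamma E A B Bw C D Dw \<gamma> Qt Zt + corner Dw (0 \<cdot>\<^sub>m M))"
proof -
  define R where "R = minv P"
  note inv = pos_def_minv[OF P, folded R_def]
  define Qt where "Qt = E * R * E\<^sup>T"
  define Zt where "Zt = E * K * F * Qt"
  have EF: "E * F = 1\<^sub>m m"
    using mat_mult_left_right_inverse[of F n E] pinv_E E pinv square by simp
  have M0: "M = 0\<^sub>m m m" unfolding M_mat_def by (simp add: EF minus_r_inv_mat[of _ m m])
  have FtEt: "F\<^sup>T *\<^sub>v (E\<^sup>T *\<^sub>v v) = v" if "v \<in> carrier_vec m" for v
  proof -
    have "(E * F)\<^sup>T = F\<^sup>T * E\<^sup>T" by (simp add: transpose_mult_dim)
    hence "F\<^sup>T * E\<^sup>T = 1\<^sub>m m" unfolding EF by simp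
    thus ?thesis using that mult_mat_vec_assoc_dim[of "F\<^sup>T" "E\<^sup>T" v] by simp
  qed
  have inj: "v = 0\<^sub>v m" if "v \<in> carrier_vec m" "E\<^sup>T *\<^sub>v v = 0\<^sub>v n" for v
    using FtEt[OF that(1)] that(2) by (simp add: mult_mat_zero_vec_dim)
  have Qt: "Qt \<in> carrier_mat m m" using inv by (auto simp: Qt_def)
  have pd: "pos_def Qt"
    using pos_def_congruence[OF inv(1,4), of "E\<^sup>T" m] inj by (simp add: Qt_def)
  have sym: "Qt\<^sup>T = Qt" using pd Qt by (simp add: pos_def_iff)
  have Zt: "Zt \<in> carrier_mat m m" using K Qt by (auto simp: Zt_def)
  note invQ = pos_def_minv[OF Qt pd]
  have "Zt * minv Qt = E * K * F"
    using K Qt invQ(1,2) by (simp add: Zt_def mult_mat_assoc_dim)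
  moreover have "F * (E * K * F) * E = (F * E) * K * (F * E)"
    using K by (simp add: mult_mat_assoc_dim)
  ultimately have gain: "F * (Zt * minv Qt) * E = K" using K by (simp add: pinv_E)
  have psd: "pos_semidef (Qt * M + M * Qt - 1 \<cdot>\<^sub>m M)"
  proof -
    have "Qt * M + M * Qt - 1 \<cdot>\<^sub>m M = 0\<^sub>m m m"
      unfolding M0 using Qt by (intro eq_matI) auto
    moreover have "(0\<^sub>m m m)\<^sup>T = (0\<^sub>m m m :: real mat)" by (rule eq_matI) auto
    ultimately show ?thesis
      by (simp add: pos_semidef_iff[of _ m] zero_mult_mat_vec_dim scalar_prod_right_zero[of _ m])
  qed
  have Y: "0 \<cdot>\<^sub>m M \<in> carrier_mat m m" "(0 \<cdot>\<^sub>m M)\<^sup>T = 0 \<cdot>\<^sub>m M"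
    using M by (simp_all add: transpose_smult_mat M_symmetric)
  have "neg_on m (\<lambda>v v2 v3. perf (E\<^sup>T *\<^sub>v v) (F *\<^sub>v (Qt *\<^sub>v v)) (F *\<^sub>v (Zt *\<^sub>v v)) v2 v3 + v \<bullet> ((0 \<cdot>\<^sub>m M) *\<^sub>v v))"
    unfolding neg_on_def
  proof (intro ballI impI)
    fix v v2 v3 :: "real vec" assume v: "v \<in> carrier_vec m" "v2 \<in> carrier_vec nw" "v3 \<in> carrier_vec ny"
      and nz: "\<not> (v = 0\<^sub>v m \<and> v2 = 0\<^sub>v nw \<and> v3 = 0\<^sub>v ny)"
    \<comment> \<open>The state represented by \<open>v\<close>, that is \<open>Qt v = E x\<close>;
      this inverts the substitution used for the opposite implication.\<close>
    define x where "x = R *\<^sub>v (E\<^sup>T *\<^sub>v v)"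
    have x: "x \<in> carrier_vec n" unfolding x_def using inv(1) by (intro carrier_vecI) simp
    have Px: "P *\<^sub>v x = E\<^sup>T *\<^sub>v v"
      using P inv v mult_mat_vec_assoc_dim[of P R "E\<^sup>T *\<^sub>v v"] by (simp add: x_def one_mult_mat_vec_dim)
    have "Qt *\<^sub>v v = E *\<^sub>v x" using inv v by (simp add: Qt_def x_def mult_mat_vec_assoc_dim)
    hence Fx: "F *\<^sub>v (Qt *\<^sub>v v) = x" using pinv_E_vec[OF x] by simp
    have "F *\<^sub>v (Zt *\<^sub>v v) = F *\<^sub>v (E *\<^sub>v (K *\<^sub>v (F *\<^sub>v (Qt *\<^sub>v v))))"
      using K Qt v by (simp add: Zt_def mult_mat_vec_assoc_dim)
    hence Kx: "F *\<^sub>v (Zt *\<^sub>v v) = K *\<^sub>v x" using K x Fx pinv_E_vec[of "K *\<^sub>v x"] by simp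
    have "v = 0\<^sub>v m" if "x = 0\<^sub>v n"
    proof (rule inj[OF v(1)])
      show "E\<^sup>T *\<^sub>v v = 0\<^sub>v n"
        unfolding Px[symmetric] that using P(1) mult_mat_zero_vec_dim[of P n] by simp
    qed
    hence "perf (P *\<^sub>v x) x (K *\<^sub>v x) v2 v3 < 0"
      using neg x v nz unfolding neg_on_def by blast
    moreover have "v \<bullet> ((0 \<cdot>\<^sub>m M) *\<^sub>v v) = 0" using v by (simp add: smult_mult_mat_vec_dim)
    ultimately show "perf (E\<^sup>T *\<^sub>v v) (F *\<^sub>v (Qt *\<^sub>v v)) (F *\<^sub>v (Zt *\<^sub>v v)) v2 v3 + v \<bullet> ((0 \<cdot>\<^sub>m M) *\<^sub>v v) < 0"
      using Px Fx Kx by simp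
  qed
  hence "neg_def (Gamma E A B Bw C D Dw \<gamma> Qt Zt + corner Dw (0 \<cdot>\<^sub>m M))"
    using lifted_lmi_iff[OF Qt sym Zt Y] by blast
  thus ?thesis using that Qt pd Zt gain psd by blast
qed

end

section \<open>Stacked and block diagonal matrices\<close>

lemma row_append_rows:
  assumes "X \<in> carrier_mat r n" "Y \<in> carrier_mat s n" "i < r + s"
  shows "row (X @\<^sub>r Y) i = (if i < r then row X i else row Y (i - r))"
  using assms by (intro eq_vecI) (auto simp: append_rows_def)

lemma col_append_rows:
  assumes "X \<in> carrier_mat r n" "Y \<in> carrier_mat s n" "j < n"
  shows "col (X @\<^sub>r Y) j = col X j @\<^sub>v col Y j"
  using assms by (intro eq_vecI) (auto simp: append_rows_def)

lemma append_rows_dims [simp]: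
  "dim_row (X @\<^sub>r Y) = dim_row X + dim_row Y" "dim_col (X @\<^sub>r Y) = dim_col X"
  by (auto simp: append_rows_def)

lemma append_rows_mult:
  assumes "X \<in> carrier_mat r n" "Y \<in> carrier_mat s n" "Z \<in> carrier_mat n k"
  shows "(X @\<^sub>r Y) * Z = (X * Z) @\<^sub>r (Y * (Z :: 'a :: semiring_0 mat))"
proof (rule eq_matI)
  fix i j assume "i < dim_row ((X * Z) @\<^sub>r (Y * Z))" "j < dim_col ((X * Z) @\<^sub>r (Y * Z))"
  hence ij: "i < r + s" "j < k" using assms by auto
  have "((X * Z) @\<^sub>r (Y * Z)) $$ (i, j) = row ((X * Z) @\<^sub>r (Y * Z)) i $ j"
    using assms ij by simp
  also have "\<dots> = (if i < r then row (X * Z) i else row (Y * Z) (i - r)) $ j"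
    using assms ij by (subst row_append_rows[of _ r k _ s]) auto
  finally show "((X @\<^sub>r Y) * Z) $$ (i, j) = ((X * Z) @\<^sub>r (Y * Z)) $$ (i, j)"
    using assms ij by (auto simp: row_append_rows[OF assms(1,2)])
qed (use assms in auto)

lemma transpose_append_rows_mult:
  assumes "X \<in> carrier_mat r n" "Y \<in> carrier_mat s n" "X' \<in> carrier_mat r k" "Y' \<in> carrier_mat s k"
  shows "(X @\<^sub>r Y)\<^sup>T * (X' @\<^sub>r Y') = X\<^sup>T * X' + Y\<^sup>T * (Y' :: 'a :: semiring_0 mat)"
proof (rule eq_matI)
  fix i j assume "i < dim_row (X\<^sup>T * X' + Y\<^sup>T * Y')" "j < dim_col (X\<^sup>T * X' + Y\<^sup>T * Y')"
  hence ij: "i < n" "j < k" using assms by auto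
  have "col (X @\<^sub>r Y) i \<bullet> col (X' @\<^sub>r Y') j = col X i \<bullet> col X' j + col Y i \<bullet> col Y' j"
    unfolding col_append_rows[OF assms(1,2) ij(1)] col_append_rows[OF assms(3,4) ij(2)]
    using assms ij by (intro scalar_prod_append[of _ r _ s]) auto
  thus "((X @\<^sub>r Y)\<^sup>T * (X' @\<^sub>r Y')) $$ (i, j) = (X\<^sup>T * X' + Y\<^sup>T * Y') $$ (i, j)"
    using assms ij by simp
qed (use assms in auto)

lemma append_rows_mult_transpose:
  assumes "X \<in> carrier_mat r n" "Y \<in> carrier_mat s n" "X' \<in> carrier_mat r' n" "Y' \<in> carrier_mat s' n"
  shows "(X @\<^sub>r Y) * (X' @\<^sub>r Y')\<^sup>T
    = four_block_mat (X * X'\<^sup>T) (X * Y'\<^sup>T) (Y * X'\<^sup>T) (Y * (Y' :: 'a :: semiring_0 mat)\<^sup>T)"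
  by (rule eq_matI) (use assms in \<open>auto simp: row_append_rows[OF assms(1,2)] row_append_rows[OF assms(3,4)]\<close>)

lemma four_block_diag_mult_append_rows:
  assumes "X \<in> carrier_mat r r" "Y \<in> carrier_mat s s" "G \<in> carrier_mat r n" "H \<in> carrier_mat s n"
  shows "four_block_mat X (0\<^sub>m r s) (0\<^sub>m s r) Y * (G @\<^sub>r H) = (X * G) @\<^sub>r (Y * (H :: 'a :: semiring_0 mat))"
  \<comment> \<open>Stacking is a \<open>four_block_mat\<close> whose right blocks have width 0;
    this is the \<open>0\<close> in the instantiation.\<close>
  unfolding append_rows_def using assms
  by (subst mult_four_block_mat[of _ r r _ s _ s _ _ n _ 0]) auto

lemma vstack_simps [simp]: "vstack n [] = 0\<^sub>m 0 n" "vstack n (X # Xs) = X @\<^sub>r vstack n Xs"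
  by (simp_all add: vstack_def)

lemma vstack_carrier:
  assumes "\<And>k. k \<in> set ks \<Longrightarrow> G k \<in> carrier_mat (d k) n"
  shows "vstack n (map G ks) \<in> carrier_mat (sum_list (map d ks)) n"
  using assms by (induction ks) auto

lemma diag_block_carrier:
  assumes "\<And>k. k \<in> set ks \<Longrightarrow> P k \<in> carrier_mat (d k) (d k)"
  shows "diag_block_mat (map P ks) \<in> carrier_mat (sum_list (map d ks)) (sum_list (map d ks))"
  using assms by (induction ks) (auto simp: Let_def)

text \<open>Expresses the sizes of the zero blocks through \<open>d\<close>, so that the two-by-two
  block rules can be applied in inductions.\<close>

lemma diag_block_Cons:
  assumes "\<And>k. k \<in> set (i # ks) \<Longrightarrow> P k \<in> carrier_mat (d k) (d k)"
  shows "diag_block_mat (map P (i # ks)) = four_block_mat (P i) (0\<^sub>m (d i) (sum_list (map d ks)))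
    (0\<^sub>m (sum_list (map d ks)) (d i)) (diag_block_mat (map P ks))"
proof -
  have "P i \<in> carrier_mat (d i) (d i)" using assms by simp
  moreover have "diag_block_mat (map P ks) \<in> carrier_mat (sum_list (map d ks)) (sum_list (map d ks))"
    using assms by (intro diag_block_carrier) simp
  ultimately show ?thesis by (simp add: Let_def)
qed

lemma diag_block_mult_vstack:
  fixes P :: "'i \<Rightarrow> real mat"
  assumes "\<And>k. k \<in> set ks \<Longrightarrow> P k \<in> carrier_mat (d k) (d k)"
    and "\<And>k. k \<in> set ks \<Longrightarrow> G k \<in> carrier_mat (d k) n"
  shows "diag_block_mat (map P ks) * vstack n (map G ks) = vstack n (map (\<lambda>k. P k * G k) ks)"
  using assms
proof (induction ks)
  case (Cons i ks)
  have D: "diag_block_mat (map P (i # ks)) = four_block_mat (P i) (0\<^sub>m (d i) (sum_list (map d ks)))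
    (0\<^sub>m (sum_list (map d ks)) (d i)) (diag_block_mat (map P ks))"
    using Cons.prems by (intro diag_block_Cons) auto
  have "diag_block_mat (map P (i # ks)) * vstack n (map G (i # ks))
      = (P i * G i) @\<^sub>r (diag_block_mat (map P ks) * vstack n (map G ks))"
    unfolding D
    unfolding list.map vstack_simps
    using Cons.prems vstack_carrier[of ks G d n] diag_block_carrier[of ks P d]
    by (intro four_block_diag_mult_append_rows) auto
  thus ?case using Cons by simp
qed simp

lemma vstack_mult:
  assumes "\<And>k. k \<in> set ks \<Longrightarrow> G k \<in> carrier_mat (d k) n" "X \<in> carrier_mat n m"
  shows "vstack n (map G ks) * X = vstack m (map (\<lambda>k. G k * X) ks)"
  using assms
proof (induction ks)
  case (Cons i ks)
  have "(G i @\<^sub>r vstack n (map G ks)) * X = (G i * X) @\<^sub>r (vstack n (map G ks) * X)"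
    using Cons.prems by (intro append_rows_mult[of _ "d i" n _ "sum_list (map d ks)" _ m] vstack_carrier) auto
  thus ?case using Cons by simp
qed simp

text \<open>Stated entrywise because matrices of varying dimension share no single zero with which
  \<open>sum_list\<close> could start.\<close>

lemma transpose_vstack_mult_vstack:
  assumes "\<And>k. k \<in> set ks \<Longrightarrow> G k \<in> carrier_mat (d k) n"
    and "\<And>k. k \<in> set ks \<Longrightarrow> H k \<in> carrier_mat (d k) m" and "i < n" "j < m"
  shows "((vstack n (map G ks))\<^sup>T * vstack m (map H ks)) $$ (i, j) = (\<Sum>k\<leftarrow>ks. ((G k)\<^sup>T * H k) $$ (i, j))"
  using assms
proof (induction ks)
  case Nil
  thus ?case by (simp add: scalar_prod_def)
next
  case (Cons k ks)
  have GH: "G k \<in> carrier_mat (d k) n" "H k \<in> carrier_mat (d k) m"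
    "vstack n (map G ks) \<in> carrier_mat (sum_list (map d ks)) n"
    "vstack m (map H ks) \<in> carrier_mat (sum_list (map d ks)) m"
    using Cons.prems by (auto intro!: vstack_carrier)
  have "((G k @\<^sub>r vstack n (map G ks))\<^sup>T * (H k @\<^sub>r vstack m (map H ks))) $$ (i, j)
      = ((G k)\<^sup>T * H k) $$ (i, j) + ((vstack n (map G ks))\<^sup>T * vstack m (map H ks)) $$ (i, j)"
    unfolding transpose_append_rows_mult[OF GH(1,3,2,4)] using GH Cons.prems(3,4) by auto
  thus ?case using Cons by simp
qed

lemma diag_block_mult:
  fixes P R :: "'i \<Rightarrow> real mat"
  assumes "\<And>k. k \<in> set ks \<Longrightarrow> P k \<in> carrier_mat (d k) (d k)"
    and "\<And>k. k \<in> set ks \<Longrightarrow> R k \<in> carrier_mat (d k) (d k)"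
  shows "diag_block_mat (map P ks) * diag_block_mat (map R ks) = diag_block_mat (map (\<lambda>k. P k * R k) ks)"
  using assms
proof (induction ks)
  case (Cons i ks)
  let ?s = "sum_list (map d ks)"
  have c: "P i \<in> carrier_mat (d i) (d i)" "R i \<in> carrier_mat (d i) (d i)"
    "diag_block_mat (map P ks) \<in> carrier_mat ?s ?s" "diag_block_mat (map R ks) \<in> carrier_mat ?s ?s"
    using Cons.prems by (auto intro!: diag_block_carrier)
  have DP: "diag_block_mat (map P (i # ks)) = four_block_mat (P i) (0\<^sub>m (d i) ?s)
    (0\<^sub>m ?s (d i)) (diag_block_mat (map P ks))"
    using Cons.prems by (intro diag_block_Cons) auto
  have DR: "diag_block_mat (map R (i # ks)) = four_block_mat (R i) (0\<^sub>m (d i) ?s)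
    (0\<^sub>m ?s (d i)) (diag_block_mat (map R ks))"
    using Cons.prems by (intro diag_block_Cons) auto
  have PR: "diag_block_mat (map (\<lambda>k. P k * R k) (i # ks)) = four_block_mat (P i * R i) (0\<^sub>m (d i) ?s)
    (0\<^sub>m ?s (d i)) (diag_block_mat (map (\<lambda>k. P k * R k) ks))"
    using Cons.prems by (intro diag_block_Cons mult_carrier_mat) auto
  have IH: "diag_block_mat (map P ks) * diag_block_mat (map R ks) = diag_block_mat (map (\<lambda>k. P k * R k) ks)"
    using Cons by simp
  show ?case
    unfolding DP DR PR IH[symmetric]
    using c by (subst mult_four_block_mat[of _ "d i" "d i" _ ?s _ ?s _ _ "d i" _ ?s]) auto
qed simp

lemma diag_block_one: "diag_block_mat (map (\<lambda>k. 1\<^sub>m (d k)) ks) = 1\<^sub>m (sum_list (map d ks))"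
  by (induction ks) (auto simp: Let_def)

lemma pos_def_four_block_diag:
  assumes X: "X \<in> carrier_mat r r" "pos_def X" and Y: "Y \<in> carrier_mat s s" "pos_def Y"
  shows "pos_def (four_block_mat X (0\<^sub>m r s) (0\<^sub>m s r) Y)"
proof -
  let ?D = "four_block_mat X (0\<^sub>m r s) (0\<^sub>m s r) Y"
  have D: "?D \<in> carrier_mat (r + s) (r + s)" using X Y by auto
  have t0: "(0\<^sub>m r s)\<^sup>T = (0\<^sub>m s r :: real mat)" "(0\<^sub>m s r)\<^sup>T = (0\<^sub>m r s :: real mat)" by (auto intro: eq_matI)
  have "?D\<^sup>T = ?D" using X Y
    by (subst transpose_four_block_mat[of _ r r _ s _ s]) (auto simp: pos_def_iff t0)
  moreover have "0 < (x @\<^sub>v y) \<bullet> (?D *\<^sub>v (x @\<^sub>v y))"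
    if v: "x \<in> carrier_vec r" "y \<in> carrier_vec s" "x @\<^sub>v y \<noteq> 0\<^sub>v (r + s)" for x y
  proof -
    have eq: "(x @\<^sub>v y) \<bullet> (?D *\<^sub>v (x @\<^sub>v y)) = x \<bullet> (X *\<^sub>v x) + y \<bullet> (Y *\<^sub>v y)"
      using X Y v quadratic_form_four_block[of X r "0\<^sub>m r s" s Y x y]
      by (simp add: t0 zero_mult_mat_vec_dim scalar_prod_right_zero[of _ r])
    have "\<not> (x = 0\<^sub>v r \<and> y = 0\<^sub>v s)" using v(3) by auto
    moreover have "0 \<le> x \<bullet> (X *\<^sub>v x)" "x \<noteq> 0\<^sub>v r \<Longrightarrow> 0 < x \<bullet> (X *\<^sub>v x)"
      using X v by (cases "x = 0\<^sub>v r"; auto simp: pos_def_iff less_imp_le scalar_prod_left_zero[of _ r])+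
    moreover have "0 \<le> y \<bullet> (Y *\<^sub>v y)" "y \<noteq> 0\<^sub>v s \<Longrightarrow> 0 < y \<bullet> (Y *\<^sub>v y)"
      using Y v by (cases "y = 0\<^sub>v s"; auto simp: pos_def_iff less_imp_le scalar_prod_left_zero[of _ s])+
    ultimately show ?thesis unfolding eq by fastforce
  qed
  ultimately show ?thesis unfolding pos_def_iff[OF D] by (simp add: all_vec_append)
qed

lemma pos_def_diag_block:
  assumes "\<And>k. k \<in> set ks \<Longrightarrow> P k \<in> carrier_mat (d k) (d k) \<and> pos_def (P k)"
  shows "pos_def (diag_block_mat (map P ks))"
  using assms
proof (induction ks)
  case Nil
  \<comment> \<open>In dimension 0 there is no nonzero vector, so definiteness is vacuous.\<close>
  have "v = 0\<^sub>v 0" if "v \<in> carrier_vec 0" for v :: "real vec" using that by auto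
  thus ?case by (auto simp: pos_def_def)
next
  case (Cons i ks)
  have D: "diag_block_mat (map P (i # ks)) = four_block_mat (P i) (0\<^sub>m (d i) (sum_list (map d ks)))
    (0\<^sub>m (sum_list (map d ks)) (d i)) (diag_block_mat (map P ks))"
    using Cons.prems by (intro diag_block_Cons) auto
  show ?case unfolding D
    using Cons by (intro pos_def_four_block_diag diag_block_carrier) auto
qed

lemma minv_diag_block:
  assumes P: "\<And>k. k \<in> set ks \<Longrightarrow> P k \<in> carrier_mat (d k) (d k) \<and> pos_def (P k)"
  shows "minv (diag_block_mat (map P ks)) = diag_block_mat (map (\<lambda>k. minv (P k)) ks)"
proof -
  have I: "minv (P k) \<in> carrier_mat (d k) (d k)" "P k * minv (P k) = 1\<^sub>m (d k)" if "k \<in> set ks" for k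
    using P[OF that] pos_def_minv by blast+
  have "diag_block_mat (map P ks) * diag_block_mat (map (\<lambda>k. minv (P k)) ks)
      = diag_block_mat (map (\<lambda>k. P k * minv (P k)) ks)"
    using P I by (intro diag_block_mult) auto
  also have "map (\<lambda>k. P k * minv (P k)) ks = map (\<lambda>k. 1\<^sub>m (d k)) ks" using I by auto
  finally show ?thesis
    using P I by (intro minv_eqI[OF diag_block_carrier diag_block_carrier]) (auto simp: diag_block_one)
qed

section \<open>Block partition and clique covers\<close>

text \<open>The node whose block contains row or column \<open>a\<close>. The least index is never
  0, since \<open>offset ns 1\<close> is an empty sum.\<close>

definition node_at :: "(nat \<Rightarrow> nat) \<Rightarrow> nat \<Rightarrow> nat" where
  "node_at ns a = (LEAST i. a < offset ns (Suc i))"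

lemma offset_Suc: "1 \<le> i \<Longrightarrow> offset ns (Suc i) = offset ns i + ns i"
  by (simp add: offset_def atLeastLessThanSuc)

lemma offset_mono: "i \<le> j \<Longrightarrow> offset ns i \<le> offset ns j"
  unfolding offset_def by (rule sum_mono2) auto

lemma dim_sys_offset: "dim_sys N ns = offset ns (Suc N)"
  by (simp add: dim_sys_def offset_def atLeastLessThanSuc_atLeastAtMost)

lemma node_at_eqI:
  assumes "offset ns i \<le> a" "a < offset ns (Suc i)"
  shows "node_at ns a = i"
  unfolding node_at_def
proof (rule Least_equality)
  fix j assume "a < offset ns (Suc j)"
  thus "i \<le> j" using offset_mono[of "Suc j" i ns] assms by linarith
qed (use assms in simp)

lemma node_at_offset:
  assumes "i \<in> {1..N}" "r < ns i"
  shows "node_at ns (offset ns i + r) = i" "offset ns i + r < dim_sys N ns"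
  using assms offset_Suc[of i ns] offset_mono[of "Suc i" "Suc N" ns]
  by (auto simp: dim_sys_offset intro!: node_at_eqI)

lemma node_at_decomp:
  assumes "a < dim_sys N ns"
  obtains r where "node_at ns a \<in> {1..N}" "r < ns (node_at ns a)" "a = offset ns (node_at ns a) + r"
proof -
  let ?i = "node_at ns a"
  have N: "a < offset ns (Suc N)" using assms by (simp add: dim_sys_offset)
  have lt: "a < offset ns (Suc ?i)" unfolding node_at_def by (rule LeastI, rule N)
  have le: "?i \<le> N" unfolding node_at_def by (rule Least_le, rule N)
  have "?i \<noteq> 0" using lt by (intro notI) (simp add: offset_def)
  then obtain k where k: "?i = Suc k" by (cases ?i) auto
  have "\<not> a < offset ns (Suc k)"
    using not_less_Least[of k "\<lambda>i. a < offset ns (Suc i)"] k by (simp add: node_at_def)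
  hence ge: "offset ns ?i \<le> a" using k by simp
  show ?thesis
    using that[of "a - offset ns ?i"] lt le ge k offset_Suc[of ?i ns] by simp
qed

lemma node_at_in: "a < dim_sys N ns \<Longrightarrow> node_at ns a \<in> {1..N}"
  using node_at_decomp by metis

text \<open>With sparsity read off single entries, scaling by node-wise diagonal matrices and
  summing over cliques can be checked entry by entry.\<close>

lemma sparse_mats_iff:
  "K \<in> sparse_mats N ns Ed \<longleftrightarrow> K \<in> carrier_mat (dim_sys N ns) (dim_sys N ns) \<and>
    (\<forall>a<dim_sys N ns. \<forall>b<dim_sys N ns. (node_at ns a, node_at ns b) \<notin> Ed \<and> node_at ns a \<noteq> node_at ns b
      \<longrightarrow> K $$ (a, b) = 0)" (is "?l \<longleftrightarrow> ?r")
proof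
  assume l: ?l
  show ?r
  proof (intro conjI allI impI)
    fix a b assume ab: "a < dim_sys N ns" "b < dim_sys N ns"
      and ne: "(node_at ns a, node_at ns b) \<notin> Ed \<and> node_at ns a \<noteq> node_at ns b"
    obtain r where r: "node_at ns a \<in> {1..N}" "r < ns (node_at ns a)" "a = offset ns (node_at ns a) + r"
      using node_at_decomp[OF ab(1)] .
    obtain s where s: "node_at ns b \<in> {1..N}" "s < ns (node_at ns b)" "b = offset ns (node_at ns b) + s"
      using node_at_decomp[OF ab(2)] .
    have "blk ns (node_at ns a) (node_at ns b) K = 0\<^sub>m (ns (node_at ns a)) (ns (node_at ns b))"
      using l r(1) s(1) ne by (auto simp: sparse_mats_def)
    hence "blk ns (node_at ns a) (node_at ns b) K $$ (r, s) = 0" using r s by simp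
    thus "K $$ (a, b) = 0" using r s by (simp add: blk_def)
  qed (use l in \<open>simp add: sparse_mats_def\<close>)
next
  assume r: ?r
  show ?l unfolding sparse_mats_def
  proof (safe intro!: eq_matI)
    fix i j a b assume ij: "i \<in> {1..N}" "j \<in> {1..N}" "(i, j) \<notin> Ed" "i \<noteq> j"
      and ab: "a < dim_row (0\<^sub>m (ns i) (ns j) :: real mat)" "b < dim_col (0\<^sub>m (ns i) (ns j) :: real mat)"
    thus "blk ns i j K $$ (a, b) = 0\<^sub>m (ns i) (ns j) $$ (a, b)"
      using r node_at_offset[OF ij(1), of a ns] node_at_offset[OF ij(2), of b ns] by (simp add: blk_def)
  qed (use r in \<open>auto simp: blk_def\<close>)
qed

text \<open>A multiple of the identity on each node block. \<open>E\<^sup>T * E\<close>, its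
  inverse, its square root and the projections onto the nodes of a clique all have this form, so
  their products reduce to products of numbers.\<close>

definition node_diag :: "nat \<Rightarrow> (nat \<Rightarrow> nat) \<Rightarrow> (nat \<Rightarrow> real) \<Rightarrow> real mat" where
  "node_diag N ns g = mat_diag (dim_sys N ns) (\<lambda>a. g (node_at ns a))"

lemma node_diag_carrier [simp]: "node_diag N ns g \<in> carrier_mat (dim_sys N ns) (dim_sys N ns)"
  by (simp add: node_diag_def)

lemma node_diag_dims [simp]: "dim_row (node_diag N ns g) = dim_sys N ns" "dim_col (node_diag N ns g) = dim_sys N ns"
  by (simp_all add: node_diag_def mat_diag_def)

lemma node_diag_index:
  "a < dim_sys N ns \<Longrightarrow> b < dim_sys N ns \<Longrightarrow> node_diag N ns g $$ (a, b) = (if a = b then g (node_at ns a) else 0)"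
  by (simp add: node_diag_def mat_diag_def)

lemma node_diag_mult: "node_diag N ns g * node_diag N ns h = node_diag N ns (\<lambda>i. g i * h i)"
  by (simp add: node_diag_def)

lemma node_diag_one: "node_diag N ns (\<lambda>i. 1) = 1\<^sub>m (dim_sys N ns)"
  by (simp add: node_diag_def)

lemma node_diag_transpose: "(node_diag N ns g)\<^sup>T = node_diag N ns g"
  by (rule eq_matI) (auto simp: node_diag_index)

lemma node_diag_cong:
  assumes "\<And>i. i \<in> {1..N} \<Longrightarrow> g i = h i"
  shows "node_diag N ns g = node_diag N ns h"
  using assms node_at_in[of _ N ns] by (intro eq_matI) (auto simp: node_diag_index)

lemma node_diag_mult_left:
  "X \<in> carrier_mat (dim_sys N ns) k \<Longrightarrow> a < dim_sys N ns \<Longrightarrow> b < k \<Longrightarrow>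
    (node_diag N ns g * X) $$ (a, b) = g (node_at ns a) * X $$ (a, b)"
  by (simp add: node_diag_def mat_diag_mult_left[of _ _ k])

lemma node_diag_mult_right:
  "X \<in> carrier_mat k (dim_sys N ns) \<Longrightarrow> a < k \<Longrightarrow> b < dim_sys N ns \<Longrightarrow>
    (X * node_diag N ns g) $$ (a, b) = X $$ (a, b) * g (node_at ns b)"
  by (simp add: node_diag_def mat_diag_mult_right[of _ k])

lemma node_diag_sandwich:
  assumes X: "X \<in> carrier_mat (dim_sys N ns) (dim_sys N ns)" and ab: "a < dim_sys N ns" "b < dim_sys N ns"
  shows "(node_diag N ns g * (X * node_diag N ns h)) $$ (a, b) = g (node_at ns a) * (X $$ (a, b) * h (node_at ns b))"
  unfolding node_diag_mult_left[OF mult_carrier_mat[OF X node_diag_carrier] ab] node_diag_mult_right[OF X ab] ..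

lemma node_diag_mult_sparse:
  assumes "Y \<in> sparse_mats N ns Ed"
  shows "node_diag N ns g * Y \<in> sparse_mats N ns Ed"
proof -
  have Y: "Y \<in> carrier_mat (dim_sys N ns) (dim_sys N ns)" using assms by (simp add: sparse_mats_iff)
  show ?thesis using assms mult_carrier_mat[OF node_diag_carrier Y]
    unfolding sparse_mats_iff by (simp add: node_diag_mult_left[OF Y] del: index_mult_mat)
qed

text \<open>A block diagonal \<open>Q\<close> couples only indices of the same node, and there the
  diagonal factor is constant.\<close>

lemma node_diag_commute:
  assumes Q: "Q \<in> carrier_mat (dim_sys N ns) (dim_sys N ns)"
    and block: "\<And>a b. a < dim_sys N ns \<Longrightarrow> b < dim_sys N ns \<Longrightarrow> Q $$ (a, b) \<noteq> 0 \<Longrightarrow> node_at ns a = node_at ns b"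
  shows "node_diag N ns g * Q = Q * node_diag N ns g"
proof (rule eq_matI)
  fix a b assume "a < dim_row (Q * node_diag N ns g)" "b < dim_col (Q * node_diag N ns g)"
  hence ab: "a < dim_sys N ns" "b < dim_sys N ns" using Q by auto
  show "(node_diag N ns g * Q) $$ (a, b) = (Q * node_diag N ns g) $$ (a, b)"
    using block[OF ab] by (cases "Q $$ (a, b) = 0") (simp_all add: node_diag_mult_left[OF Q ab] node_diag_mult_right[OF Q ab])
qed (use Q in auto)

section \<open>Selection matrices of nodes and cliques\<close>

lemma E_node_carrier: "E_node N ns j \<in> carrier_mat (ns j) (dim_sys N ns)"
  by (simp add: E_node_def)

lemma E_node_dims [simp]: "dim_row (E_node N ns j) = ns j" "dim_col (E_node N ns j) = dim_sys N ns"
  by (simp_all add: E_node_def)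

lemma E_node_mult_transpose:
  assumes "j \<in> {1..N}"
  shows "E_node N ns j * (E_node N ns j)\<^sup>T = 1\<^sub>m (ns j)"
proof (rule eq_matI)
  fix r s assume "r < dim_row (1\<^sub>m (ns j) :: real mat)" "s < dim_col (1\<^sub>m (ns j) :: real mat)"
  hence rs: "r < ns j" "s < ns j" by auto
  have "(E_node N ns j * (E_node N ns j)\<^sup>T) $$ (r, s) =
      (\<Sum>b\<in>{0..<dim_sys N ns}. (if b = offset ns j + r then 1 else 0) * (if b = offset ns j + s then 1 else 0))"
    using rs by (simp add: scalar_prod_def E_node_def)
  also have "\<dots> = (\<Sum>b\<in>{0..<dim_sys N ns}. if b = offset ns j + r then (if b = offset ns j + s then 1 else 0) else 0)"
    by (rule sum.cong) auto
  also have "\<dots> = (if r = s then 1 else 0)"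
    using node_at_offset(2)[OF assms, of r ns, OF rs(1)] by (simp add: sum.delta)
  finally show "(E_node N ns j * (E_node N ns j)\<^sup>T) $$ (r, s) = 1\<^sub>m (ns j) $$ (r, s)" using rs by simp
qed auto

lemma transpose_mult_E_node:
  assumes "j \<in> {1..N}"
  shows "(E_node N ns j)\<^sup>T * E_node N ns j = node_diag N ns (\<lambda>i. if i = j then 1 else 0)"
proof (rule eq_matI)
  fix a b assume "a < dim_row (node_diag N ns (\<lambda>i. if i = j then 1 else 0))"
    "b < dim_col (node_diag N ns (\<lambda>i. if i = j then 1 else 0))"
  hence ab: "a < dim_sys N ns" "b < dim_sys N ns" by (auto simp: node_diag_index)
  obtain r where r: "r < ns (node_at ns a)" "a = offset ns (node_at ns a) + r"
    using node_at_decomp[OF ab(1)] .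
  have "((E_node N ns j)\<^sup>T * E_node N ns j) $$ (a, b) =
      (\<Sum>s\<in>{0..<ns j}. (if a = offset ns j + s then 1 else 0) * (if b = offset ns j + s then 1 else 0))"
    using ab by (simp add: scalar_prod_def E_node_def)
  also have "\<dots> = (\<Sum>s\<in>{0..<ns j}. if a = offset ns j + s then (if b = a then 1 else 0) else 0)"
    by (rule sum.cong) auto
  also have "\<dots> = (if a = b \<and> node_at ns a = j then 1 else 0)"
  proof (cases "node_at ns a = j")
    case True
    hence "(\<lambda>s. if a = offset ns j + s then (if b = a then 1 else 0) else 0) =
        (\<lambda>s. if r = s then (if b = a then 1 else (0 :: real)) else 0)"
      using r by auto
    thus ?thesis using True r by (simp add: sum.delta)
  next
    case False
    hence "a \<noteq> offset ns j + s" if "s < ns j" for s using node_at_offset(1)[OF assms, of s ns, OF that] by auto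
    thus ?thesis using False by simp
  qed
  finally show "((E_node N ns j)\<^sup>T * E_node N ns j) $$ (a, b) =
      node_diag N ns (\<lambda>i. if i = j then 1 else 0) $$ (a, b)"
    using ab by (simp add: node_diag_index)
qed (auto simp: node_diag_index)

lemma E_nodes:
  fixes js :: "nat list" and ns :: "nat \<Rightarrow> nat"
  assumes "distinct js" "set js \<subseteq> {1..N}"
  defines "V \<equiv> vstack (dim_sys N ns) (map (E_node N ns) js)"
  shows "V \<in> carrier_mat (\<Sum>j\<leftarrow>js. ns j) (dim_sys N ns)"
    and "V\<^sup>T * V = node_diag N ns (\<lambda>i. if i \<in> set js then 1 else 0)"
    and "V * V\<^sup>T = 1\<^sub>m (\<Sum>j\<leftarrow>js. ns j)"
  using assms(1,2) unfolding V_def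
proof (induction js)
  case Nil
  { case 1 show ?case by simp }
  { case 2 show ?case by (rule eq_matI) (auto simp: node_diag_index scalar_prod_def) }
  { case 3 show ?case by (rule eq_matI) auto }
next
  case (Cons j js)
  let ?n = "dim_sys N ns" and ?m = "\<Sum>j\<leftarrow>js. ns j"
  let ?X = "E_node N ns j" and ?Y = "vstack (dim_sys N ns) (map (E_node N ns) js)"
  have X: "?X \<in> carrier_mat (ns j) ?n" by (rule E_node_carrier)
  {
    assume prems: "distinct (j # js)" "set (j # js) \<subseteq> {1..N}"
    hence j: "j \<in> {1..N}" "j \<notin> set js" and Y: "?Y \<in> carrier_mat ?m ?n"
      and YtY: "?Y\<^sup>T * ?Y = node_diag N ns (\<lambda>i. if i \<in> set js then 1 else 0)"
      and YYt: "?Y * ?Y\<^sup>T = 1\<^sub>m ?m"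
      using Cons by auto
    note XtX = transpose_mult_E_node[OF j(1), of ns] and XXt = E_node_mult_transpose[OF j(1), of ns]
    show "vstack ?n (map (E_node N ns) (j # js)) \<in> carrier_mat (\<Sum>j\<leftarrow>j # js. ns j) ?n"
      using X Y by auto
    have "(vstack ?n (map (E_node N ns) (j # js)))\<^sup>T * vstack ?n (map (E_node N ns) (j # js))
        = ?X\<^sup>T * ?X + ?Y\<^sup>T * ?Y"
      using transpose_append_rows_mult[OF X Y X Y] by simp
    also have "\<dots> = node_diag N ns (\<lambda>i. if i \<in> set (j # js) then 1 else 0)"
      unfolding XtX YtY using j(2) by (intro eq_matI) (auto simp: node_diag_index)
    finally show "(vstack ?n (map (E_node N ns) (j # js)))\<^sup>T * vstack ?n (map (E_node N ns) (j # js)) = \<dots>" .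
    \<comment> \<open>Orthonormality of the rows allows the projections
      \<open>?X\<^sup>T * ?X\<close> and \<open>?Y\<^sup>T * ?Y\<close> to be inserted in the
      middle. Their supports are disjoint because \<open>j\<close> does not recur in
      \<open>js\<close>.\<close>
    have "?X * ?Y\<^sup>T = (?X * ?X\<^sup>T * ?X) * (?Y * ?Y\<^sup>T * ?Y)\<^sup>T"
      unfolding XXt YYt using X Y by simp
    also have "\<dots> = ?X * ((?X\<^sup>T * ?X) * (?Y\<^sup>T * ?Y)) * ?Y\<^sup>T"
      using X Y by (simp add: transpose_mult_dim mult_mat_assoc_dim)
    also have "(?X\<^sup>T * ?X) * (?Y\<^sup>T * ?Y) = 0\<^sub>m ?n ?n"
      unfolding XtX YtY node_diag_mult using j(2) by (intro eq_matI) (auto simp: node_diag_index)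
    finally have XY: "?X * ?Y\<^sup>T = 0\<^sub>m (ns j) ?m" using X Y by simp
    have "?Y * ?X\<^sup>T = (?X * ?Y\<^sup>T)\<^sup>T" using X Y by (simp add: transpose_mult_dim)
    hence YX: "?Y * ?X\<^sup>T = 0\<^sub>m ?m (ns j)" unfolding XY by (intro eq_matI) auto
    have "vstack ?n (map (E_node N ns) (j # js)) * (vstack ?n (map (E_node N ns) (j # js)))\<^sup>T
        = four_block_mat (?X * ?X\<^sup>T) (?X * ?Y\<^sup>T) (?Y * ?X\<^sup>T) (?Y * ?Y\<^sup>T)"
      using append_rows_mult_transpose[OF X Y X Y] by simp
    also have "\<dots> = 1\<^sub>m (\<Sum>j\<leftarrow>j # js. ns j)" unfolding XY YX XXt YYt by simp
    finally show "vstack ?n (map (E_node N ns) (j # js)) * (vstack ?n (map (E_node N ns) (j # js)))\<^sup>T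
        = 1\<^sub>m (\<Sum>j\<leftarrow>j # js. ns j)" .
  }
qed

lemma E_clique:
  assumes "c \<subseteq> {1..N}"
  shows "E_clique N ns c \<in> carrier_mat (dim_clique ns c) (dim_sys N ns)"
    and "(E_clique N ns c)\<^sup>T * E_clique N ns c = node_diag N ns (\<lambda>i. if i \<in> c then 1 else 0)"
    and "E_clique N ns c * (E_clique N ns c)\<^sup>T = 1\<^sub>m (dim_clique ns c)"
proof -
  have fin: "finite c" using assms finite_subset by blast
  have "(\<Sum>j\<leftarrow>sorted_list_of_set c. ns j) = dim_clique ns c"
    using fin by (simp add: dim_clique_def sum_list_distinct_conv_sum_set)
  thus "E_clique N ns c \<in> carrier_mat (dim_clique ns c) (dim_sys N ns)"
    "(E_clique N ns c)\<^sup>T * E_clique N ns c = node_diag N ns (\<lambda>i. if i \<in> c then 1 else 0)"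
    "E_clique N ns c * (E_clique N ns c)\<^sup>T = 1\<^sub>m (dim_clique ns c)"
    using E_nodes[of "sorted_list_of_set c" N ns] assms fin unfolding E_clique_def by auto
qed

text \<open>The start \<open>s\<close> of the list is general because removing the first block
  shifts the local indices by \<open>ns s\<close>, while \<open>offset ns s + a\<close> remains the
  global index. The induction counts the remaining blocks; an empty list admits no
  \<open>a\<close>.\<close>

lemma diag_block_entry_nonzero:
  fixes Qs :: "nat \<Rightarrow> real mat"
  assumes "\<forall>i\<in>{s..N}. Qs i \<in> carrier_mat (ns i) (ns i)" "1 \<le> s"
    and "a < (\<Sum>i\<in>{s..N}. ns i)" "b < (\<Sum>i\<in>{s..N}. ns i)"
    and "diag_block_mat (map Qs [s..<Suc N]) $$ (a, b) \<noteq> 0"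
  shows "node_at ns (offset ns s + a) = node_at ns (offset ns s + b)"
  using assms
proof (induction "Suc N - s" arbitrary: s a b)
  case 0
  thus ?case by simp
next
  case (Suc k)
  hence sN: "s \<le> N" by simp
  let ?D = "diag_block_mat (map Qs [Suc s..<Suc N])"
  have sum: "(\<Sum>i\<in>{s..N}. ns i) = ns s + (\<Sum>i\<in>{Suc s..N}. ns i)"
    using sN by (simp add: sum.atLeast_Suc_atMost)
  have Qs: "Qs s \<in> carrier_mat (ns s) (ns s)" using Suc.prems sN by simp
  have "?D \<in> carrier_mat (\<Sum>i\<leftarrow>[Suc s..<Suc N]. ns i) (\<Sum>i\<leftarrow>[Suc s..<Suc N]. ns i)"
    using Suc.prems by (intro diag_block_carrier) auto
  moreover have "(\<Sum>i\<leftarrow>[Suc s..<Suc N]. ns i) = (\<Sum>i\<in>{Suc s..N}. ns i)"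
    by (simp only: interv_sum_list_conv_sum_set_nat set_upt atLeastLessThanSuc_atLeastAtMost)
  ultimately have D: "?D \<in> carrier_mat (\<Sum>i\<in>{Suc s..N}. ns i) (\<Sum>i\<in>{Suc s..N}. ns i)" by simp
  have "[s..<Suc N] = s # [Suc s..<Suc N]" using sN by (simp add: upt_rec)
  hence nz: "four_block_mat (Qs s) (0\<^sub>m (ns s) (\<Sum>i\<in>{Suc s..N}. ns i)) (0\<^sub>m (\<Sum>i\<in>{Suc s..N}. ns i) (ns s)) ?D $$ (a, b) \<noteq> 0"
    using Suc.prems(5) Qs D by (simp add: Let_def)
  have off: "offset ns (Suc s) = offset ns s + ns s" using Suc.prems(2) by (rule offset_Suc)
  show ?case
  proof (cases "a < ns s")
    case True
    hence "b < ns s" using nz Qs D Suc.prems(3,4) sum by (auto split: if_splits)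
    thus ?thesis using True node_at_offset(1)[of s N _ ns] sN Suc.prems(2) by simp
  next
    case False
    hence b: "\<not> b < ns s" and nz': "?D $$ (a - ns s, b - ns s) \<noteq> 0"
      using nz Qs D Suc.prems(3,4) sum by (auto split: if_splits)
    have "node_at ns (offset ns (Suc s) + (a - ns s)) = node_at ns (offset ns (Suc s) + (b - ns s))"
      using Suc.hyps(2) Suc.prems nz' False b sum by (intro Suc.hyps(1)) auto
    thus ?thesis using False b off by simp
  qed
qed

section \<open>Lifting along a cover of the nodes by cliques\<close>

locale clique_cover =
  fixes N q :: nat and ns :: "nat \<Rightarrow> nat" and Cl :: "nat \<Rightarrow> nat set"
  assumes Cl: "\<And>k. k \<in> {1..q} \<Longrightarrow> Cl k \<subseteq> {1..N}"
    and cover: "\<And>i. i \<in> {1..N} \<Longrightarrow> cliques_at q Cl i \<noteq> {}"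
begin

abbreviation "n \<equiv> dim_sys N ns"
abbreviation "dk k \<equiv> dim_clique ns (Cl k)"
abbreviation "m \<equiv> \<Sum>k\<leftarrow>[1..<Suc q]. dk k"
abbreviation "Ek k \<equiv> E_clique N ns (Cl k)"
abbreviation "E \<equiv> E_mat N ns q Cl"
abbreviation "w i \<equiv> real (card (cliques_at q Cl i))"
abbreviation "\<Delta> g \<equiv> node_diag N ns g"
abbreviation "proj k \<equiv> node_diag N ns (\<lambda>i. if i \<in> Cl k then 1 else 0)"
abbreviation "diag X \<equiv> diag_block_mat (map X [1..<Suc q])"

lemma sum_list_range: "(\<Sum>k\<leftarrow>[1..<Suc q]. f k) = (\<Sum>k\<in>{1..q}. f k :: real)"
  by (simp only: interv_sum_list_conv_sum_set_nat set_upt atLeastLessThanSuc_atLeastAtMost)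

lemma w_pos: "i \<in> {1..N} \<Longrightarrow> w i > 0"
  using cover[of i] by (simp add: cliques_at_def card_gt_0_iff)

lemma Ek:
  assumes "k \<in> {1..q}"
  shows "Ek k \<in> carrier_mat (dk k) n" "(Ek k)\<^sup>T * Ek k = proj k" "Ek k * (Ek k)\<^sup>T = 1\<^sub>m (dk k)"
  using E_clique[OF Cl[OF assms], of ns] by auto

lemma Ek_dims [simp]:
  assumes "k \<in> {1..q}"
  shows "dim_row (Ek k) = dk k" "dim_col (Ek k) = n"
  using Ek(1)[OF assms] by auto

lemma Ek_proj: "k \<in> {1..q} \<Longrightarrow> Ek k * proj k = Ek k"
  using Ek(3)[of k] by (simp add: Ek(2)[symmetric] mult_mat_assoc_dim[symmetric])

lemma E_carrier: "E \<in> carrier_mat m n"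
  unfolding E_mat_def by (rule vstack_carrier) (use Ek(1) in auto)

lemma E_dims [simp]: "dim_row E = m" "dim_col E = n"
  using E_carrier by auto

lemma diag_mult_E:
  assumes "\<forall>k\<in>{1..q}. X k \<in> carrier_mat (dk k) (dk k)"
  shows "diag X * E = vstack n (map (\<lambda>k. X k * Ek k) [1..<Suc q])"
  unfolding E_mat_def by (rule diag_block_mult_vstack[of _ _ dk]) (use assms Ek(1) in auto)

text \<open>The Lyapunov matrix, the matrix \<open>E\<^sup>T * Zt * E\<close> and, up to a diagonal
  factor, the gain are of this shape, so each is a sum of contributions of single cliques.\<close>

lemma E_congruence_index:
  assumes X: "\<forall>k\<in>{1..q}. X k \<in> carrier_mat (dk k) (dk k)" and ab: "a < n" "b < n"
  shows "(E\<^sup>T * (diag X * E)) $$ (a, b) = (\<Sum>k\<in>{1..q}. ((Ek k)\<^sup>T * (X k * Ek k)) $$ (a, b))"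
proof -
  have "(E\<^sup>T * (diag X * E)) $$ (a, b) = (\<Sum>k\<leftarrow>[1..<Suc q]. ((Ek k)\<^sup>T * (X k * Ek k)) $$ (a, b))"
    unfolding diag_mult_E[OF X] unfolding E_mat_def
  proof (rule transpose_vstack_mult_vstack[OF _ _ ab])
    fix k assume k: "k \<in> set [1..<Suc q]"
    hence k': "k \<in> {1..q}" by auto
    show "Ek k \<in> carrier_mat (dk k) n" by (rule Ek(1)[OF k'])
    thus "X k * Ek k \<in> carrier_mat (dk k) n" using bspec[OF X k'] by simp
  qed
  thus ?thesis by (simp only: sum_list_range)
qed

lemma E_gram: "E\<^sup>T * E = \<Delta> w"
proof (rule eq_matI)
  fix a b assume "a < dim_row (\<Delta> w)" "b < dim_col (\<Delta> w)"
  hence ab: "a < n" "b < n" by auto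
  have "(E\<^sup>T * E) $$ (a, b) = (\<Sum>k\<leftarrow>[1..<Suc q]. ((Ek k)\<^sup>T * Ek k) $$ (a, b))"
    unfolding E_mat_def by (rule transpose_vstack_mult_vstack[OF _ _ ab]) (use Ek(1) in auto)
  also have "\<dots> = (\<Sum>k\<in>{1..q}. ((Ek k)\<^sup>T * Ek k) $$ (a, b))" by (rule sum_list_range)
  also have "\<dots> = (\<Sum>k\<in>{1..q}. if a = b \<and> node_at ns a \<in> Cl k then 1 else 0)"
    using ab by (intro sum.cong) (auto simp: Ek(2) node_diag_index)
  also have "\<dots> = \<Delta> w $$ (a, b)"
    using ab by (simp add: node_diag_index cliques_at_def sum.If_cases Int_def)
  finally show "(E\<^sup>T * E) $$ (a, b) = \<Delta> w $$ (a, b)" .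
qed auto

text \<open>The pseudoinverse averages the \<open>w i\<close> copies of node \<open>i\<close>; the
  cover keeps these weights nonzero.\<close>

lemma E_pinv_eq: "E_pinv E = \<Delta> (\<lambda>i. 1 / w i) * E\<^sup>T"
proof -
  have "\<Delta> w * \<Delta> (\<lambda>i. 1 / w i) = 1\<^sub>m n"
    unfolding node_diag_mult node_diag_one[symmetric] using w_pos by (intro node_diag_cong) force
  hence "minv (E\<^sup>T * E) = \<Delta> (\<lambda>i. 1 / w i)"
    unfolding E_gram by (intro minv_eqI[of _ n]) auto
  thus ?thesis by (simp add: E_pinv_def)
qed

lemma E_pinv_carrier: "E_pinv E \<in> carrier_mat n m"
  unfolding E_pinv_eq by (rule carrier_matI) auto

lemma E_pinv_dims [simp]: "dim_row (E_pinv E) = n" "dim_col (E_pinv E) = m"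
  using E_pinv_carrier by auto

lemma E_pinv_mult_E: "E_pinv E * E = 1\<^sub>m n"
proof -
  have "\<Delta> (\<lambda>i. 1 / w i) * \<Delta> w = 1\<^sub>m n"
    unfolding node_diag_mult node_diag_one[symmetric] using w_pos by (intro node_diag_cong) force
  thus ?thesis by (simp add: E_pinv_eq mult_mat_assoc_dim E_gram)
qed

lemma E_pinv_transpose: "(E_pinv E)\<^sup>T = E * \<Delta> (\<lambda>i. 1 / w i)"
  by (simp add: E_pinv_eq transpose_mult_dim node_diag_transpose)

lemma E_mult_pinv_symmetric: "(E * E_pinv E)\<^sup>T = E * E_pinv E"
  by (simp add: transpose_mult_dim E_pinv_transpose) (simp add: E_pinv_eq mult_mat_assoc_dim)

text \<open>The factor \<open>\<Delta> g\<close> lets one statement serve both \<open>P\<close>,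
  with \<open>g\<close> constantly 1, and the gain, where \<open>g\<close> is the averaging weight
  of the pseudoinverse.\<close>

lemma E_congruence_sparse:
  assumes X: "\<forall>k\<in>{1..q}. X k \<in> carrier_mat (dk k) (dk k)"
    and cl: "\<forall>k\<in>{1..q}. clique N Ed (Cl k)"
  shows "\<Delta> g * (E\<^sup>T * (diag X * E)) \<in> sparse_mats N ns Ed"
proof -
  have c: "diag X \<in> carrier_mat m m" by (rule diag_block_carrier) (use X in auto)
  have c': "E\<^sup>T * (diag X * E) \<in> carrier_mat n n" using c by (intro carrier_matI) auto
  have "(E\<^sup>T * (diag X * E)) $$ (a, b) = 0"
    if ab: "a < n" "b < n" and ne: "(node_at ns a, node_at ns b) \<notin> Ed" "node_at ns a \<noteq> node_at ns b" for a b
  proof -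
    have "((Ek k)\<^sup>T * (X k * Ek k)) $$ (a, b) = 0" if k: "k \<in> {1..q}" for k
    proof -
      let ?Y = "(Ek k)\<^sup>T * (X k * Ek k)"
      have Y: "?Y \<in> carrier_mat n n" using k X by (intro carrier_matI) auto
      \<comment> \<open>Inserting \<open>proj k\<close> on both sides multiplies the entry by the
        indicators of its two nodes in \<open>Cl k\<close>. Distinct nonadjacent nodes never lie in
        one clique, so one indicator is 0.\<close>
      have "?Y = (Ek k * proj k)\<^sup>T * (X k * (Ek k * proj k))" using Ek_proj[OF k] by simp
      also have "\<dots> = proj k * (?Y * proj k)"
        using k bspec[OF X k] by (simp add: transpose_mult_dim node_diag_transpose mult_mat_assoc_dim)
      finally have "?Y $$ (a, b) = (proj k * (?Y * proj k)) $$ (a, b)" by simp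
      also have "\<dots> = (if node_at ns a \<in> Cl k then 1 else 0) * (?Y $$ (a, b) * (if node_at ns b \<in> Cl k then 1 else 0))"
        unfolding node_diag_sandwich[OF Y ab] by simp
      also have "\<dots> = 0" using bspec[OF cl k] ne by (auto simp: clique_def)
      finally show ?thesis .
    qed
    thus ?thesis unfolding E_congruence_index[OF X ab] by (intro sum.neutral) blast
  qed
  hence "E\<^sup>T * (diag X * E) \<in> sparse_mats N ns Ed" unfolding sparse_mats_iff using c' by blast
  thus ?thesis by (rule node_diag_mult_sparse)
qed

lemma DD_carrier: "X \<in> DD ns q Cl \<Longrightarrow> X \<in> carrier_mat m m"
  unfolding DD_def by (auto intro!: diag_block_carrier simp del: upt_Suc)

lemma DD_pos_carrier:
  assumes "X \<in> DD_pos ns q Cl"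
  shows "X \<in> carrier_mat m m" "pos_def X"
proof -
  obtain P where X: "X = diag P" and P: "\<forall>k\<in>{1..q}. P k \<in> carrier_mat (dk k) (dk k) \<and> pos_def (P k)"
    using assms unfolding DD_pos_def by blast
  show "X \<in> carrier_mat m m" unfolding X by (rule diag_block_carrier) (use P in auto)
  show "pos_def X" unfolding X by (rule pos_def_diag_block[of _ _ dk]) (use P in auto)
qed

text \<open>With at most one clique, block diagonality is no restriction. For \<open>q = 0\<close>
  the only matrix is the empty one, which is the empty block diagonal matrix.\<close>

lemma square_DD:
  assumes "q \<le> 1" and X: "X \<in> carrier_mat m m"
  shows "X \<in> DD ns q Cl" "pos_def X \<Longrightarrow> X \<in> DD_pos ns q Cl"
proof -
  have "q = 0 \<or> q = 1" using assms by auto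
  hence "X = diag (\<lambda>_. X) \<and> (\<forall>k\<in>{1..q}. X \<in> carrier_mat (dk k) (dk k))"
    using X by auto
  thus "X \<in> DD ns q Cl" "pos_def X \<Longrightarrow> X \<in> DD_pos ns q Cl"
    unfolding DD_def DD_pos_def by blast+
qed

text \<open>Multiplying by the pseudoinverse and its transpose divides block \<open>(i, j)\<close>
  by \<open>w i * w j\<close> after summing over the cliques that contain both nodes. For a diagonal
  block the sum has \<open>w i\<close> terms, so \<open>Q\<close> has to be scaled by
  \<open>w i\<close>; a general block of \<open>Z\<close> has to be scaled by
  \<open>w i * w j\<close> over the number of common cliques.\<close>

lemma block_lift:
  assumes Q: "Q \<in> carrier_mat n n" "pos_def Q"
    and block: "\<And>a b. a < n \<Longrightarrow> b < n \<Longrightarrow> Q $$ (a, b) \<noteq> 0 \<Longrightarrow> node_at ns a = node_at ns b"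
    and Z: "Z \<in> sparse_mats N ns Ed"
    and edges: "\<And>i j. i \<in> {1..N} \<Longrightarrow> j \<in> {1..N} \<Longrightarrow> i \<noteq> j \<Longrightarrow> (i, j) \<in> Ed \<Longrightarrow> cliques_at q Cl i \<inter> cliques_at q Cl j \<noteq> {}"
  obtains Qt Zt where "Qt \<in> DD_pos ns q Cl" "Zt \<in> DD ns q Cl"
    "Qt \<in> carrier_mat m m" "pos_def Qt" "Zt \<in> carrier_mat m m"
    "E_pinv E * Qt * (E_pinv E)\<^sup>T = Q" "E_pinv E * Zt * (E_pinv E)\<^sup>T = Z"
    "Qt * M_mat E = M_mat E * Qt" "E_pinv E * (Zt * minv Qt) * E = Z * minv Q"
proof -
  let ?wi = "\<lambda>i. 1 / w i" and ?s = "\<lambda>i. sqrt (w i)"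
  have comm: "\<Delta> g * Q = Q * \<Delta> g" for g
    by (rule node_diag_commute[OF Q(1) block])
  have Zc: "Z \<in> carrier_mat n n" using Z by (simp add: sparse_mats_iff)
  have "\<Delta> (\<lambda>i. w i * ?wi i) = 1\<^sub>m n" "\<Delta> (\<lambda>i. ?wi i * w i) = 1\<^sub>m n"
    unfolding node_diag_one[symmetric] using w_pos by (force intro!: node_diag_cong)+
  hence ww: "\<Delta> w * \<Delta> ?wi = 1\<^sub>m n" "\<Delta> ?wi * \<Delta> w = 1\<^sub>m n"
    unfolding node_diag_mult by simp_all
  \<comment> \<open>The blocks of \<open>Qt\<close> are those of \<open>Q\<close> scaled by the number of cliques containing the node;
    splitting the factor symmetrically makes positive definiteness evident.\<close>
  define G where "G = (\<lambda>k. \<Delta> ?s * (Ek k)\<^sup>T)"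
  define Qk where "Qk = (\<lambda>k. (G k)\<^sup>T * Q * G k)"
  have G: "G k \<in> carrier_mat n (dk k)" if "k \<in> {1..q}" for k
    unfolding G_def using that by (intro carrier_matI) auto
  have Qk: "Qk k \<in> carrier_mat (dk k) (dk k)" if "k \<in> {1..q}" for k
    unfolding Qk_def using G[OF that] by (intro carrier_matI) auto
  have Qk_pos: "pos_def (Qk k)" if k: "k \<in> {1..q}" for k
    unfolding Qk_def
  proof (rule pos_def_congruence[OF Q G[OF k]])
    fix v assume v: "v \<in> carrier_vec (dk k)" "G k *\<^sub>v v = 0\<^sub>v n"
    have "\<Delta> (\<lambda>i. 1 / ?s i) * \<Delta> ?s = 1\<^sub>m n"
      unfolding node_diag_mult node_diag_one[symmetric] using w_pos by (intro node_diag_cong) force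
    hence "\<Delta> (\<lambda>i. 1 / ?s i) * G k = (Ek k)\<^sup>T"
      using k by (simp add: G_def mult_mat_assoc_dim[symmetric])
    hence "Ek k * (\<Delta> (\<lambda>i. 1 / ?s i) * G k) = 1\<^sub>m (dk k)" using Ek(3)[OF k] by simp
    hence "v = (Ek k * (\<Delta> (\<lambda>i. 1 / ?s i) * G k)) *\<^sub>v v" using v by simp
    also have "\<dots> = Ek k *\<^sub>v (\<Delta> (\<lambda>i. 1 / ?s i) *\<^sub>v (G k *\<^sub>v v))"
      using v k G[OF k] by (simp add: mult_mat_vec_assoc_dim)
    also have "\<dots> = 0\<^sub>v (dk k)" using k by (simp add: v(2) mult_mat_zero_vec_dim)
    finally show "v = 0\<^sub>v (dk k)" .
  qed
  \<comment> \<open>\<open>Q\<close> commutes with every \<open>\<Delta> g\<close>, so the two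
    square roots merge into \<open>\<Delta> w\<close> and the projection is absorbed by
    \<open>Ek k\<close>.\<close>
  have Qk_Ek: "Qk k * Ek k = Ek k * (Q * \<Delta> w)" if k: "k \<in> {1..q}" for k
  proof -
    have ss: "\<Delta> ?s * (\<Delta> ?s * proj k) = proj k * \<Delta> w"
      unfolding node_diag_mult by (intro node_diag_cong) auto
    have "Qk k * Ek k = Ek k * (\<Delta> ?s * (Q * (\<Delta> ?s * ((Ek k)\<^sup>T * Ek k))))"
      using k Q by (simp add: Qk_def G_def transpose_mult_dim node_diag_transpose mult_mat_assoc_dim)
    also have "\<Delta> ?s * (Q * (\<Delta> ?s * ((Ek k)\<^sup>T * Ek k))) = (\<Delta> ?s * Q) * (\<Delta> ?s * proj k)"
      using Q by (simp add: Ek(2)[OF k] mult_mat_assoc_dim)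
    also have "\<dots> = Q * (proj k * \<Delta> w)"
      unfolding comm using Q by (simp add: mult_mat_assoc_dim ss)
    also have "\<dots> = proj k * (Q * \<Delta> w)"
      using Q comm[of "\<lambda>i. if i \<in> Cl k then 1 else 0"]
      by (simp add: mult_mat_assoc_dim[symmetric])
    also have "Ek k * \<dots> = Ek k * proj k * (Q * \<Delta> w)"
      using k Q by (simp add: mult_mat_assoc_dim)
    also have "\<dots> = Ek k * (Q * \<Delta> w)" by (simp add: Ek_proj[OF k])
    finally show ?thesis .
  qed
  define Qt where "Qt = diag Qk"
  have Qt: "Qt \<in> carrier_mat m m" unfolding Qt_def by (rule diag_block_carrier) (use Qk in auto)
  have Qt_pos: "pos_def Qt" unfolding Qt_def by (rule pos_def_diag_block[of _ _ dk]) (use Qk Qk_pos in auto)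
  have Qt_sym: "Qt\<^sup>T = Qt" using Qt_pos Qt by (simp add: pos_def_iff)
  have Qt_E: "Qt * E = E * (Q * \<Delta> w)"
  proof -
    have "Qt * E = vstack n (map (\<lambda>k. Qk k * Ek k) [1..<Suc q])"
      unfolding Qt_def by (rule diag_mult_E) (use Qk in blast)
    also have "map (\<lambda>k. Qk k * Ek k) [1..<Suc q] = map (\<lambda>k. Ek k * (Q * \<Delta> w)) [1..<Suc q]"
      using Qk_Ek by (intro map_cong) auto
    also have "vstack n \<dots> = E * (Q * \<Delta> w)"
      unfolding E_mat_def by (rule vstack_mult[symmetric, of _ _ dk]) (use Ek(1) Q in auto)
    finally show ?thesis .
  qed
  have FQ: "E_pinv E * Qt * (E_pinv E)\<^sup>T = Q"
  proof -
    have "E_pinv E * Qt * (E_pinv E)\<^sup>T = E_pinv E * (Qt * E) * \<Delta> ?wi"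
      using Qt by (simp add: E_pinv_transpose mult_mat_assoc_dim)
    also have "\<dots> = (E_pinv E * E) * (Q * (\<Delta> w * \<Delta> ?wi))"
      unfolding Qt_E using Q by (simp add: mult_mat_assoc_dim)
    also have "\<dots> = Q" unfolding E_pinv_mult_E ww using Q by simp
    finally show ?thesis .
  qed
  \<comment> \<open>The result is symmetric, so transposition shows that \<open>Qt\<close> commutes
    with \<open>E * E_pinv E\<close> and hence with \<open>M_mat E\<close>.\<close>
  have QtEF: "Qt * (E * E_pinv E) = E * (Q * E\<^sup>T)"
  proof -
    have "Qt * (E * E_pinv E) = (Qt * E) * (\<Delta> ?wi * E\<^sup>T)"
      using Qt by (simp add: E_pinv_eq mult_mat_assoc_dim)
    also have "\<dots> = E * (Q * ((\<Delta> w * \<Delta> ?wi) * E\<^sup>T))"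
      unfolding Qt_E using Q by (simp add: mult_mat_assoc_dim)
    also have "\<dots> = E * (Q * E\<^sup>T)" unfolding ww by simp
    finally show ?thesis .
  qed
  have "(E * E_pinv E) * Qt = (Qt * (E * E_pinv E))\<^sup>T"
    using Qt Qt_sym by (subst transpose_mult_dim) (auto simp: E_mult_pinv_symmetric)
  also have "\<dots> = E * (Q * E\<^sup>T)"
    unfolding QtEF using Q by (simp add: transpose_mult_dim mult_mat_assoc_dim pos_def_iff)
  finally have EFQt: "(E * E_pinv E) * Qt = E * (Q * E\<^sup>T)" .
  have EF: "E * E_pinv E \<in> carrier_mat m m" by (intro carrier_matI) auto
  have comm_M: "Qt * M_mat E = M_mat E * Qt"
    unfolding M_mat_def E_dims
    using Qt QtEF EFQt mult_minus_distrib_mat[OF Qt one_carrier_mat EF] minus_mult_distrib_mat[OF one_carrier_mat EF Qt]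
    by simp
  \<comment> \<open>Each block of \<open>Z\<close> is shared equally among the cliques containing both nodes. If there are none,
    the block of \<open>Z\<close> vanishes, so the division by zero is harmless.\<close>
  define Y where "Y = mat n n (\<lambda>(a, b). w (node_at ns a) * w (node_at ns b) * Z $$ (a, b)
      / real (card (cliques_at q Cl (node_at ns a) \<inter> cliques_at q Cl (node_at ns b))))"
  have Y: "Y \<in> carrier_mat n n" by (simp add: Y_def)
  define Zk where "Zk = (\<lambda>k. Ek k * Y * (Ek k)\<^sup>T)"
  have Zk: "Zk k \<in> carrier_mat (dk k) (dk k)" if "k \<in> {1..q}" for k
    unfolding Zk_def using that by (intro carrier_matI) auto
  define Zt where "Zt = diag Zk"
  have Zt: "Zt \<in> carrier_mat m m" unfolding Zt_def by (rule diag_block_carrier) (use Zk in auto)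
  have EZE: "E\<^sup>T * (Zt * E) = \<Delta> w * Z * \<Delta> w"
  proof (rule eq_matI)
    fix a b assume "a < dim_row (\<Delta> w * Z * \<Delta> w)" "b < dim_col (\<Delta> w * Z * \<Delta> w)"
    hence ab: "a < n" "b < n" by auto
    let ?i = "node_at ns a" and ?j = "node_at ns b"
    let ?c = "real (card (cliques_at q Cl ?i \<inter> cliques_at q Cl ?j))"
    have ij: "?i \<in> {1..N}" "?j \<in> {1..N}" using ab node_at_in by blast+
    have "((Ek k)\<^sup>T * (Zk k * Ek k)) $$ (a, b) = (if ?i \<in> Cl k \<and> ?j \<in> Cl k then Y $$ (a, b) else 0)"
      if k: "k \<in> {1..q}" for k
    proof -
      have "(Ek k)\<^sup>T * (Zk k * Ek k) = ((Ek k)\<^sup>T * Ek k) * (Y * ((Ek k)\<^sup>T * Ek k))"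
        using k Y by (simp add: Zk_def mult_mat_assoc_dim)
      thus ?thesis unfolding Ek(2)[OF k] by (simp only: node_diag_sandwich[OF Y ab]) simp
    qed
    hence "(E\<^sup>T * (Zt * E)) $$ (a, b) = (\<Sum>k\<in>{1..q}. if ?i \<in> Cl k \<and> ?j \<in> Cl k then Y $$ (a, b) else 0)"
      unfolding Zt_def using Zk by (subst E_congruence_index[OF _ ab]) auto
    also have "\<dots> = Y $$ (a, b) * real (card ({1..q} \<inter> {k. ?i \<in> Cl k \<and> ?j \<in> Cl k}))"
      by (simp add: sum.If_cases)
    also have "{1..q} \<inter> {k. ?i \<in> Cl k \<and> ?j \<in> Cl k} = cliques_at q Cl ?i \<inter> cliques_at q Cl ?j"
      by (auto simp: cliques_at_def)
    also have "Y $$ (a, b) * ?c = w ?i * Z $$ (a, b) * w ?j"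
    proof (cases "cliques_at q Cl ?i \<inter> cliques_at q Cl ?j = {}")
      case True
      hence "?i \<noteq> ?j" using cover[OF ij(1)] by auto
      moreover from this have "(?i, ?j) \<notin> Ed" using True edges[OF ij] by blast
      ultimately have "Z $$ (a, b) = 0" using Z ab by (simp add: sparse_mats_iff)
      thus ?thesis using ab by (simp add: Y_def)
    next
      case False
      moreover have "finite (cliques_at q Cl ?i \<inter> cliques_at q Cl ?j)" by (simp add: cliques_at_def)
      ultimately have "?c \<noteq> 0" by simp
      thus ?thesis using ab by (simp add: Y_def)
    qed
    also have "\<dots> = (\<Delta> w * Z * \<Delta> w) $$ (a, b)"
      using node_diag_sandwich[OF Zc ab, of w w] Zc by (simp only: mult_mat_assoc_dim node_diag_dims carrier_matD)
    finally show "(E\<^sup>T * (Zt * E)) $$ (a, b) = (\<Delta> w * Z * \<Delta> w) $$ (a, b)" .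
  qed (use Zc in auto)
  have FZ: "E_pinv E * Zt * (E_pinv E)\<^sup>T = Z"
  proof -
    have "E_pinv E * Zt * (E_pinv E)\<^sup>T = \<Delta> ?wi * (E\<^sup>T * (Zt * E)) * \<Delta> ?wi"
      using Zt unfolding E_pinv_transpose by (simp add: E_pinv_eq mult_mat_assoc_dim)
    also have "\<dots> = (\<Delta> ?wi * \<Delta> w) * (Z * (\<Delta> w * \<Delta> ?wi))"
      unfolding EZE using Zc by (simp add: mult_mat_assoc_dim)
    also have "\<dots> = Z" unfolding ww using Zc by simp
    finally show ?thesis .
  qed
  note invQ = pos_def_minv[OF Q] and invQt = pos_def_minv[OF Qt Qt_pos]
  \<comment> \<open>This inverts \<open>Qt_E\<close>. As \<open>E * \<Delta> ?wi\<close> is the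
    transposed pseudoinverse, it turns the lifted gain into the product of \<open>FZ\<close> with
    \<open>minv Q\<close>.\<close>
  have "minv Qt * E = E * (\<Delta> ?wi * minv Q)"
  proof -
    have "Qt * (E * (\<Delta> ?wi * minv Q)) = (Qt * E) * (\<Delta> ?wi * minv Q)"
      using Qt invQ(1) by (simp add: mult_mat_assoc_dim)
    also have "\<dots> = E * (Q * ((\<Delta> w * \<Delta> ?wi) * minv Q))"
      unfolding Qt_E using Q invQ(1) by (simp add: mult_mat_assoc_dim)
    also have "\<dots> = E * (Q * minv Q)" unfolding ww using invQ(1) by simp
    also have "\<dots> = E" unfolding invQ by simp
    finally have "minv Qt * E = minv Qt * (Qt * (E * (\<Delta> ?wi * minv Q)))" by simp
    also have "\<dots> = (minv Qt * Qt) * (E * (\<Delta> ?wi * minv Q))"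
      using Qt invQ(1) invQt(1) by (simp add: mult_mat_assoc_dim)
    also have "\<dots> = E * (\<Delta> ?wi * minv Q)" unfolding invQt using invQ(1) by simp
    finally show ?thesis .
  qed
  hence "E_pinv E * (Zt * minv Qt) * E = E_pinv E * (Zt * (E * (\<Delta> ?wi * minv Q)))"
    using Zt invQt(1) by (simp add: mult_mat_assoc_dim)
  also have "\<dots> = (E_pinv E * Zt * (E_pinv E)\<^sup>T) * minv Q"
    using Zt invQ(1) by (simp add: E_pinv_transpose mult_mat_assoc_dim)
  finally have gain: "E_pinv E * (Zt * minv Qt) * E = Z * minv Q" unfolding FZ .
  have "Qt \<in> DD_pos ns q Cl" "Zt \<in> DD ns q Cl"
    unfolding DD_pos_def DD_def Qt_def Zt_def using Qk Qk_pos Zk by blast+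
  thus ?thesis using that Qt Qt_pos Zt FQ FZ comm_M gain by blast
qed

end

section \<open>The chain of inclusions and the complete case\<close>

theorem theorem4:
  fixes N q nw ny :: nat and ns :: "nat \<Rightarrow> nat" and Ed :: "(nat \<times> nat) set"
    and Cl :: "nat \<Rightarrow> nat set" and A B Bw C D Dw :: "real mat" and \<gamma> :: real
  assumes graph: "undirected_graph N Ed"
    and cliques: "\<forall>k\<in>{1..q}. clique N Ed (Cl k)"
    and distinct: "inj_on Cl {1..q}"
    and ns_pos: "\<forall>i\<in>{1..N}. ns i > 0"
    and A: "A \<in> carrier_mat (dim_sys N ns) (dim_sys N ns)"
    and B: "B \<in> carrier_mat (dim_sys N ns) (dim_sys N ns)"
    and Bw: "Bw \<in> carrier_mat (dim_sys N ns) nw"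
    and C: "C \<in> carrier_mat ny (dim_sys N ns)"
    and D: "D \<in> carrier_mat ny (dim_sys N ns)"
    and Dw: "Dw \<in> carrier_mat ny nw"
    and cover: "\<forall>i\<in>{1..N}. cliques_at q Cl i \<noteq> {}"
    and edges: "\<forall>i\<in>{1..N}. \<forall>j\<in>{1..N}. i \<noteq> j \<longrightarrow>
      (cliques_at q Cl i \<inter> cliques_at q Cl j \<noteq> {} \<longleftrightarrow> (i, j) \<in> Ed)"
  shows "(K_diag N ns Ed A B Bw C D Dw \<gamma> \<subseteq> K_rlx1 N ns q Cl A B Bw C D Dw \<gamma> \<and>
      K_rlx1 N ns q Cl A B Bw C D Dw \<gamma> \<subseteq> K_hat N ns q Cl A B Bw C D Dw \<gamma> \<and>
      K_hat N ns q Cl A B Bw C D Dw \<gamma> \<subseteq> K_S N ns Ed A B Bw C D Dw \<gamma>) \<and>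
    (complete_graph N Ed \<and> (\<forall>k\<in>{1..q}. maximal_clique N Ed (Cl k)) \<longrightarrow>
      K_diag N ns Ed A B Bw C D Dw \<gamma> \<subseteq> K_rlx1 N ns q Cl A B Bw C D Dw \<gamma> \<and>
      K_rlx1 N ns q Cl A B Bw C D Dw \<gamma> = K_hat N ns q Cl A B Bw C D Dw \<gamma> \<and>
      K_hat N ns q Cl A B Bw C D Dw \<gamma> = K_S N ns Ed A B Bw C D Dw \<gamma>)"
proof -
  interpret cc: clique_cover N q ns Cl
    using cliques cover by unfold_locales (auto simp: clique_def)
  interpret L: lifted_plant "dim_sys N ns" nw ny A B Bw C D Dw \<gamma> cc.m cc.E
    using A B Bw C D Dw cc.E_carrier cc.E_pinv_carrier cc.E_pinv_mult_E cc.E_mult_pinv_symmetric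
    by unfold_locales
  let ?n = "dim_sys N ns"
  have diag_rlx: "K_diag N ns Ed A B Bw C D Dw \<gamma> \<subseteq> K_rlx1 N ns q Cl A B Bw C D Dw \<gamma>"
  proof
    fix K assume "K \<in> K_diag N ns Ed A B Bw C D Dw \<gamma>"
    then obtain Z Q Qs where K: "K = Z * minv Q"
      and Qs: "\<forall>i\<in>{1..N}. Qs i \<in> carrier_mat (ns i) (ns i)" "Q = diag_block_mat (map Qs [1..<Suc N])"
      and Q_pos: "pos_def Q" and Z: "Z \<in> sparse_mats N ns Ed"
      and lmi: "neg_def (block3
          (He (A * Q + B * Z)) Bw (Q * C\<^sup>T + Z\<^sup>T * D\<^sup>T)
          (Bw\<^sup>T) (- \<gamma> \<cdot>\<^sub>m 1\<^sub>m (dim_col Dw)) (Dw\<^sup>T)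
          (C * Q + D * Z) Dw (- \<gamma> \<cdot>\<^sub>m 1\<^sub>m (dim_row Dw)))"
      unfolding K_diag_def by blast
    have "(\<Sum>i\<leftarrow>[1..<Suc N]. ns i) = ?n"
      by (simp only: interv_sum_list_conv_sum_set_nat set_upt atLeastLessThanSuc_atLeastAtMost dim_sys_def)
    moreover have "Q \<in> carrier_mat (\<Sum>i\<leftarrow>[1..<Suc N]. ns i) (\<Sum>i\<leftarrow>[1..<Suc N]. ns i)"
      unfolding Qs(2) by (rule diag_block_carrier) (use Qs(1) in auto)
    ultimately have Q: "Q \<in> carrier_mat ?n ?n" by simp
    have Q_sym: "Q\<^sup>T = Q" using Q_pos Q by (simp add: pos_def_iff)
    have Zc: "Z \<in> carrier_mat ?n ?n" using Z by (simp add: sparse_mats_iff)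
    \<comment> \<open>Starting at node 1 the offset is 0, so positions within the block diagonal
      matrix are global indices.\<close>
    have block: "node_at ns a = node_at ns b" if "a < ?n" "b < ?n" "Q $$ (a, b) \<noteq> 0" for a b
      using diag_block_entry_nonzero[OF Qs(1), of a b] that
      by (simp add: Qs(2) dim_sys_def offset_def del: upt_Suc)
    obtain Qt Zt where DD: "Qt \<in> DD_pos ns q Cl" "Zt \<in> DD ns q Cl"
      and Qt: "Qt \<in> carrier_mat cc.m cc.m" "pos_def Qt" and Zt: "Zt \<in> carrier_mat cc.m cc.m"
      and FQ: "E_pinv cc.E * Qt * (E_pinv cc.E)\<^sup>T = Q" and FZ: "E_pinv cc.E * Zt * (E_pinv cc.E)\<^sup>T = Z"
      and commute: "Qt * M_mat cc.E = M_mat cc.E * Qt"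
      and gain: "E_pinv cc.E * (Zt * minv Qt) * cc.E = Z * minv Q"
      using cc.block_lift[OF Q Q_pos block Z] edges by blast
    have "L.neg_on ?n (\<lambda>x. L.perf x (Q *\<^sub>v x) (Z *\<^sub>v x))"
      using lmi L.synthesis_lmi_iff[OF Q Q_sym Zc] by blast
    from L.synthesis_imp_relaxed_lmi[OF Q Q_sym Zc Qt Zt FQ FZ commute this]
    show "K \<in> K_rlx1 N ns q Cl A B Bw C D Dw \<gamma>"
      unfolding K_rlx1_def Let_def K gain[symmetric] using DD by blast
  qed
  have rlx_hat: "K_rlx1 N ns q Cl A B Bw C D Dw \<gamma> \<subseteq> K_hat N ns q Cl A B Bw C D Dw \<gamma>"
  proof
    fix K assume "K \<in> K_rlx1 N ns q Cl A B Bw C D Dw \<gamma>"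
    then obtain Zt Qt \<rho> \<eta> where K: "K = E_pinv cc.E * (Zt * minv Qt) * cc.E"
      and DD: "Zt \<in> DD ns q Cl" "Qt \<in> DD_pos ns q Cl"
      and eta: "\<eta> > 0" "pos_semidef (Qt * M_mat cc.E + M_mat cc.E * Qt - \<eta> \<cdot>\<^sub>m M_mat cc.E)"
      and lmi: "neg_def (Gamma cc.E A B Bw C D Dw \<gamma> Qt Zt + corner Dw (\<rho> \<cdot>\<^sub>m M_mat cc.E))"
      unfolding K_rlx1_def Let_def by blast
    note Qt = cc.DD_pos_carrier[OF DD(2)]
    have "Qt\<^sup>T = Qt" using Qt by (simp add: pos_def_iff)
    from L.relaxed_lmi_imp_lifted[OF Qt(1) this cc.DD_carrier[OF DD(1)] eta lmi]
    show "K \<in> K_hat N ns q Cl A B Bw C D Dw \<gamma>"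
      unfolding K_hat_def Let_def using K DD by blast
  qed
  have hat_S: "K_hat N ns q Cl A B Bw C D Dw \<gamma> \<subseteq> K_S N ns Ed A B Bw C D Dw \<gamma>"
  proof
    fix K assume "K \<in> K_hat N ns q Cl A B Bw C D Dw \<gamma>"
    then obtain Zt Qt \<rho> where K: "K = E_pinv cc.E * (Zt * minv Qt) * cc.E"
      and DD: "Zt \<in> DD ns q Cl" "Qt \<in> DD_pos ns q Cl"
      and lmi: "neg_def (Gamma cc.E A B Bw C D Dw \<gamma> Qt Zt + corner Dw (\<rho> \<cdot>\<^sub>m (Qt * M_mat cc.E * Qt)))"
      unfolding K_hat_def Let_def by blast
    note Qt = cc.DD_pos_carrier[OF DD(2)] and Zt = cc.DD_carrier[OF DD(1)]
    obtain Z' where Z': "Zt = cc.diag Z'" "\<And>k. k \<in> {1..q} \<Longrightarrow> Z' k \<in> carrier_mat (cc.dk k) (cc.dk k)"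
      using DD(1) unfolding DD_def by blast
    obtain Q' where Q': "Qt = cc.diag Q'"
      "\<And>k. k \<in> {1..q} \<Longrightarrow> Q' k \<in> carrier_mat (cc.dk k) (cc.dk k) \<and> pos_def (Q' k)"
      using DD(2) unfolding DD_pos_def by blast
    \<comment> \<open>Inverses and products of block diagonal matrices stay block diagonal, which
      brings both \<open>P\<close> and \<open>K\<close> into the form of a sum over cliques.\<close>
    have inv: "minv Qt = cc.diag (\<lambda>k. minv (Q' k))"
      unfolding Q'(1) by (rule minv_diag_block[of _ _ cc.dk]) (use Q'(2) in auto)
    have inv_c: "minv (Q' k) \<in> carrier_mat (cc.dk k) (cc.dk k)" if "k \<in> {1..q}" for k
      using Q'(2)[OF that] pos_def_minv(1) by blast
    have prod: "Zt * minv Qt = cc.diag (\<lambda>k. Z' k * minv (Q' k))"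
      unfolding inv Z'(1) by (rule diag_block_mult[of _ _ cc.dk]) (use Z'(2) inv_c in auto)
    note invQt = pos_def_minv[OF Qt]
    let ?P = "cc.E\<^sup>T * minv Qt * cc.E"
    have Pc: "?P \<in> carrier_mat ?n ?n" using invQt(1) by (intro carrier_matI) auto
    have "?P = cc.\<Delta> (\<lambda>_. 1) * (cc.E\<^sup>T * (cc.diag (\<lambda>k. minv (Q' k)) * cc.E))"
      using invQt(1) unfolding inv[symmetric] by (simp add: mult_mat_assoc_dim node_diag_one)
    hence P: "?P \<in> sparse_mats N ns Ed"
      using cc.E_congruence_sparse[OF _ cliques, of "\<lambda>k. minv (Q' k)" "\<lambda>_. 1"] inv_c by simp
    have K_eq: "K = cc.\<Delta> (\<lambda>i. 1 / cc.w i) * (cc.E\<^sup>T * (cc.diag (\<lambda>k. Z' k * minv (Q' k)) * cc.E))"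
      using Zt invQt(1) unfolding K prod[symmetric] by (simp add: cc.E_pinv_eq mult_mat_assoc_dim)
    have "\<forall>k\<in>{1..q}. Z' k * minv (Q' k) \<in> carrier_mat (cc.dk k) (cc.dk k)"
    proof
      fix k assume k: "k \<in> {1..q}"
      show "Z' k * minv (Q' k) \<in> carrier_mat (cc.dk k) (cc.dk k)"
        by (rule mult_carrier_mat[OF Z'(2)[OF k] inv_c[OF k]])
    qed
    hence KS: "K \<in> sparse_mats N ns Ed"
      unfolding K_eq by (rule cc.E_congruence_sparse[OF _ cliques])
    note an = L.lifted_imp_analysis[OF Qt Zt lmi, folded K]
    have Ps: "?P\<^sup>T = ?P" using an(1) Pc by (simp add: pos_def_iff)
    have Kc: "K \<in> carrier_mat ?n ?n" using KS by (simp add: sparse_mats_iff)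
    show "K \<in> K_S N ns Ed A B Bw C D Dw \<gamma>"
      unfolding K_S_def using KS P an(1) an(2) L.analysis_lmi_iff[OF Pc Ps Kc] by blast
  qed
  have S_rlx: "K_S N ns Ed A B Bw C D Dw \<gamma> \<subseteq> K_rlx1 N ns q Cl A B Bw C D Dw \<gamma>"
    if "complete_graph N Ed" and maximal: "\<forall>k\<in>{1..q}. maximal_clique N Ed (Cl k)"
  proof
    \<comment> \<open>Completeness makes the full node set a clique, nonempty because it contains
      \<open>Cl k\<close>; maximality leaves no room below it.\<close>
    have all: "Cl k = {1..N}" if k: "k \<in> {1..q}" for k
    proof -
      have "clique N Ed (Cl k)" using cliques k by blast
      hence sub: "Cl k \<noteq> {}" "Cl k \<subseteq> {1..N}" by (auto simp: clique_def)
      hence "clique N Ed {1..N}"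
        using \<open>complete_graph N Ed\<close> by (auto simp: clique_def complete_graph_def)
      thus ?thesis using maximal k sub(2) unfolding maximal_clique_def by blast
    qed
    \<comment> \<open>Two cliques would both be the full node set, contradicting
      distinctness.\<close>
    have q: "q \<le> 1"
    proof (rule ccontr)
      assume "\<not> q \<le> 1"
      hence "1 \<in> {1..q}" "2 \<in> {1..q}" by auto
      thus False using all[of 1] all[of 2] inj_onD[OF distinct, of 1 2] by simp
    qed
    have square: "cc.m = ?n"
    proof (cases "q = 0")
      \<comment> \<open>Without cliques the cover leaves no nodes, and both dimensions are
        0.\<close>
      case True
      have "i \<notin> {1..N}" for i using cc.cover[of i] True by (auto simp: cliques_at_def)
      hence "{1..N} = {}" by blast
      thus ?thesis using True by (simp add: dim_sys_def)
    next
      case False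
      hence "q = 1" using q by simp
      thus ?thesis using all[of 1] by (simp add: dim_clique_def dim_sys_def)
    qed
    fix K assume "K \<in> K_S N ns Ed A B Bw C D Dw \<gamma>"
    then obtain P where KS: "K \<in> sparse_mats N ns Ed" and PS: "P \<in> sparse_mats N ns Ed" and P: "pos_def P"
      and lmi: "neg_def (block3
          ((A + B * K)\<^sup>T * P + P * (A + B * K)) (P * Bw) ((C + D * K)\<^sup>T)
          (Bw\<^sup>T * P) (- \<gamma> \<cdot>\<^sub>m 1\<^sub>m (dim_col Dw)) (Dw\<^sup>T)
          (C + D * K) Dw (- \<gamma> \<cdot>\<^sub>m 1\<^sub>m (dim_row Dw)))"
      unfolding K_S_def by blast
    have Kc: "K \<in> carrier_mat ?n ?n" and Pc: "P \<in> carrier_mat ?n ?n"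
      using KS PS by (simp_all add: sparse_mats_iff)
    have "P\<^sup>T = P" using P Pc by (simp add: pos_def_iff)
    hence "L.neg_on ?n (\<lambda>x. L.perf (P *\<^sub>v x) x (K *\<^sub>v x))"
      using lmi L.analysis_lmi_iff[OF Pc _ Kc] by blast
    from L.analysis_imp_relaxed_lmi_square[OF square Pc P Kc this]
    obtain Qt Zt where Qt: "Qt \<in> carrier_mat cc.m cc.m" "pos_def Qt" and Zt: "Zt \<in> carrier_mat cc.m cc.m"
      and gain: "E_pinv cc.E * (Zt * minv Qt) * cc.E = K"
      and psd: "pos_semidef (Qt * M_mat cc.E + M_mat cc.E * Qt - 1 \<cdot>\<^sub>m M_mat cc.E)"
      and neg: "neg_def (Gamma cc.E A B Bw C D Dw \<gamma> Qt Zt + corner Dw (0 \<cdot>\<^sub>m M_mat cc.E))" .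
    have DD: "Qt \<in> DD_pos ns q Cl" "Zt \<in> DD ns q Cl"
      using cc.square_DD[OF q] Qt Zt by blast+
    have "\<exists>\<rho> \<eta>. \<eta> > 0 \<and> pos_semidef (Qt * M_mat cc.E + M_mat cc.E * Qt - \<eta> \<cdot>\<^sub>m M_mat cc.E) \<and>
        neg_def (Gamma cc.E A B Bw C D Dw \<gamma> Qt Zt + corner Dw (\<rho> \<cdot>\<^sub>m M_mat cc.E))"
      by (rule exI[of _ 0], rule exI[of _ 1], intro conjI psd neg) simp
    thus "K \<in> K_rlx1 N ns q Cl A B Bw C D Dw \<gamma>"
      unfolding K_rlx1_def Let_def gain[symmetric] using DD by blast
  qed
  show ?thesis using diag_rlx rlx_hat hat_S S_rlx by blast
qed

end
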